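(* Let $\mathbf{f}:\mathbb{C}^s\to\mathbb{C}^t$ with $t\ge s$ be a nonlinear system and let $\hat{\mathbf{x}}$ be an isolated zero of $\mathbf{f}$ with depth $\delta_{\hat{\mathbf{x}}}(\mathbf{f})$. Then there is an integer $\sigma\le\delta_{\hat{\mathbf{x}}}(\mathbf{f})$ such that the depth-deflation process (defined in the context) terminates at the expanded system $\mathbf{f}_\sigma(\mathbf{x}_1,\dots,\mathbf{x}_{2^\sigma})$ with a simple zero $(\hat{\mathbf{x}}_1,\dots,\hat{\mathbf{x}}_{2^\sigma})$, where $\hat{\mathbf{x}}_1=\hat{\mathbf{x}}$. Furthermore, the depth-deflation method generates $2^\sigma$ differential functionals in the dual space $\mathcal{D}_{\hat{\mathbf{x}}}(\mathbf{f})$.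
   Context: Functions are assumed to have all the partial derivatives that arise. A zero is isolated if it is the only zero of the system in some neighborhood. A zero of a system is simple if the Jacobian matrix of the system at the zero is injective (full column rank), and multiple otherwise. Differential functionals. For $\mathbf{j}=(j_1,\dots,j_s)$ with nonnegative integer entries write $|\mathbf{j}|=j_1+\cdots+j_s$ and $$\partial_{\mathbf{j}}[\hat{\mathbf{x}}](f)=\frac{1}{j_1!\cdots j_s!}\,\frac{\partial^{|\mathbf{j}|}f}{\partial x_1^{j_1}\cdots\partial x_s^{j_s}}(\hat{\mathbf{x}});$$ by convention $\partial_{\mathbf{j}}[\hat{\mathbf{x}}]=0$ if some $j_i<0$. A differential functional at $\hat{\mathbf{x}}$ is a finite complex linear combination $c=\sum_{\mathbf{j}} c_{\mathbf{j}}\partial_{\mathbf{j}}[\hat{\mathbf{x}}]$; its differential order is the largest $|\mathbf{j}|$ with $c_{\mathbf{j}}\ne0$. For $\mathbf{f}=[f_1,\dots,f_t]^\top$ write $c(\mathbf{f})=\{c(f_1),\dots,c(f_t)\}$. For $i=1,\dots,s$, the linear anti-differentiation map $\phi_i$ is defined by $\phi_i(\partial_{j_1\cdots j_s}[\hat{\mathbf{x}}])=\partial_{j_1'\cdots j_s'}[\hat{\mathbf{x}}]$ with $j_i'=j_i-1$ and $j_\sigma'=j_\sigma$ for $\sigma\neq i$. Dual space and depth. $\mathcal{D}^0_{\hat{\mathbf{x}}}(\mathbf{f})=\mathrm{span}\{\partial_{0\cdots0}[\hat{\mathbf{x}}]\}$ and, for $\alpha\ge1$, $\mathcal{D}^\alpha_{\hat{\mathbf{x}}}(\mathbf{f})$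 is the set of $c=\sum_{|\mathbf{j}|\le\alpha}c_{\mathbf{j}}\partial_{\mathbf{j}}[\hat{\mathbf{x}}]$ with $c(\mathbf{f})=\{0\}$ and $\phi_i(c)\in\mathcal{D}^{\alpha-1}_{\hat{\mathbf{x}}}(\mathbf{f})$ for all $i=1,\dots,s$. If $\mathcal{D}^\gamma_{\hat{\mathbf{x}}}(\mathbf{f})=\mathcal{D}^{\gamma-1}_{\hat{\mathbf{x}}}(\mathbf{f})$ for some $\gamma\ge1$, the dual space is $\mathcal{D}_{\hat{\mathbf{x}}}(\mathbf{f})=\mathcal{D}^\gamma_{\hat{\mathbf{x}}}(\mathbf{f})$, i.e. the union of all $\mathcal{D}^\alpha_{\hat{\mathbf{x}}}(\mathbf{f})$. The depth $\delta_{\hat{\mathbf{x}}}(\mathbf{f})$ is the highest differential order of functionals in $\mathcal{D}_{\hat{\mathbf{x}}}(\mathbf{f})$. Depth-deflation process. Put $\mathbf{f}_0(\mathbf{x}_1)=\mathbf{f}(\mathbf{x}_1)$ and $\hat{\mathbf{x}}_1=\hat{\mathbf{x}}$. Given $\mathbf{f}_\alpha(\mathbf{x}_1,\dots,\mathbf{x}_{2^\alpha})$ (each $\mathbf{x}_k$ a vector of $s$ variables) and an isolated zero $(\hat{\mathbf{x}}_1,\dots,\hat{\mathbf{x}}_{2^\alpha})$, let $J_\alpha$ be the Jacobian of $\mathbf{f}_\alpha$ with respect to all its $2^\alpha s$ variables. If the zero is simple, the process terminates. Otherwise let $R_{\alpha+1}$ be a randomly selected matrix with $2^\alpha s$ columns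 and number of rows equal to the nullity of $J_\alpha(\hat{\mathbf{x}}_1,\dots,\hat{\mathbf{x}}_{2^\alpha})$, such that $\begin{bmatrix}J_\alpha(\hat{\mathbf{x}}_1,\dots,\hat{\mathbf{x}}_{2^\alpha})\\R_{\alpha+1}\end{bmatrix}$ has full column rank (as holds for almost all choices). With $\mathbf{e}_1=[1,0,\dots,0]^\top$, define $$\mathbf{f}_{\alpha+1}(\mathbf{x}_1,\dots,\mathbf{x}_{2^{\alpha+1}})=\begin{bmatrix}\mathbf{f}_\alpha(\mathbf{x}_1,\dots,\mathbf{x}_{2^\alpha})\\[2pt] \begin{bmatrix}J_\alpha(\mathbf{x}_1,\dots,\mathbf{x}_{2^\alpha})\\R_{\alpha+1}\end{bmatrix}\begin{bmatrix}\mathbf{x}_{2^\alpha+1}\\ \vdots\\ \mathbf{x}_{2^{\alpha+1}}\end{bmatrix}-\begin{bmatrix}\mathbf{0}\\ \mathbf{e}_1\end{bmatrix}\end{bmatrix},$$ and let $(\hat{\mathbf{x}}_{2^\alpha+1},\dots,\hat{\mathbf{x}}_{2^{\alpha+1}})$ be the unique solution of the linear system $\begin{bmatrix}J_\alpha(\hat{\mathbf{x}}_1,\dots,\hat{\mathbf{x}}_{2^\alpha})\\R_{\alpha+1}\end{bmatrix}\mathbf{y}=\begin{bmatrix}\mathbf{0}\\ \mathbf{e}_1\end{bmatrix}$. Then $(\hat{\mathbf{x}}_1,\dots,\hat{\mathbf{x}}_{2^{\alpha+1}})$ is an isolated zero of $\mathbf{f}_{\alpha+1}$, and the process continues. Functionals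 generated. For vectors of variables $\mathbf{u},\mathbf{v}$ of length $s$ put $\mathbf{v}\cdot\Delta_{\mathbf{u}}=v_1\frac{\partial}{\partial u_1}+\cdots+v_s\frac{\partial}{\partial u_s}$, and let $\Phi_{\nu+1}=\sum_{\zeta=1}^{2^\nu}\mathbf{x}_{2^\nu+\zeta}\cdot\Delta_{\mathbf{x}_\zeta}$ for $\nu=0,1,\dots$. The $2^\sigma$ functionals generated after $\sigma$ steps are, one for each subset $\{\mu_1>\cdots>\mu_k\}$ of $\{1,\dots,\sigma\}$ (the empty subset giving $f\mapsto f(\hat{\mathbf{x}}_1)$), $$f\longmapsto \Phi_{\mu_1}\circ\cdots\circ\Phi_{\mu_k}f(\mathbf{x}_1)\big|_{(\mathbf{x}_1,\dots,\mathbf{x}_{2^\sigma})=(\hat{\mathbf{x}}_1,\dots,\hat{\mathbf{x}}_{2^\sigma})}.$$ They are not claimed to be linearly independent. *)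

theory Defs
  imports "HOL-Analysis.Analysis" "HOL-Library.Function_Algebras"
begin

section \<open>Partial derivatives and smoothness\<close>

definition coord_upd :: "complex ^ 's \<Rightarrow> 's::finite \<Rightarrow> complex \<Rightarrow> complex ^ 's" where
  "coord_upd x i z = (\<chi> j. if j = i then z else x $ j)"

definition partial :: "'s::finite \<Rightarrow> (complex ^ 's \<Rightarrow> complex) \<Rightarrow> complex ^ 's \<Rightarrow> complex" where
  "partial i g x = deriv (\<lambda>z. g (coord_upd x i z)) (x $ i)"

definition partials :: "'s::finite list \<Rightarrow> (complex ^ 's \<Rightarrow> complex) \<Rightarrow> complex ^ 's \<Rightarrow> complex" where
  "partials ds g = foldr partial ds g"

text \<open>All iterated complex partial derivatives exist and are continuous near \<open>x\<close>.\<close>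

definition smooth_near :: "complex ^ 's::finite \<Rightarrow> (complex ^ 's \<Rightarrow> complex) \<Rightarrow> bool" where
  "smooth_near x g \<longleftrightarrow> (\<exists>U. open U \<and> x \<in> U \<and>
     (\<forall>ds. continuous_on U (partials ds g) \<and>
       (\<forall>i. \<forall>y\<in>U. (\<lambda>z. partials ds g (coord_upd y i z)) field_differentiable at (y $ i))))"


section \<open>Differential functionals, dual space and depth\<close>

text \<open>A multi-index is a map \<open>'s \<Rightarrow> nat\<close>. The linear order on the index type \<open>'s\<close> is the order
  of the coordinates \<open>x\<^sub>1, \<dots>, x\<^sub>s\<close>.\<close>

definition mdeg :: "('s::finite \<Rightarrow> nat) \<Rightarrow> nat" where
  "mdeg j = (\<Sum>i\<in>UNIV. j i)"

definition pdiff :: "('s::{finite,linorder} \<Rightarrow> nat) \<Rightarrow> complex ^ 's::{finite,linorder} \<Rightarrow> (complex ^ 's::{finite,linorder} \<Rightarrow> complex) \<Rightarrow> complex" where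
  "pdiff j x g = foldr (\<lambda>i. partial i ^^ j i) (sorted_list_of_set UNIV) g x / (\<Prod>i\<in>UNIV. fact (j i))"

text \<open>The functional \<open>c = \<Sum>\<^sub>j c\<^sub>j \<partial>\<^sub>j[x]\<close> is represented by its coefficient family
  \<open>j \<mapsto> c\<^sub>j\<close>. Finiteness of the support is guaranteed in \<open>dual_upto\<close> below by the degree bound.\<close>

definition apply_functional ::
  "(('s::{finite,linorder} \<Rightarrow> nat) \<Rightarrow> complex) \<Rightarrow> complex ^ 's::{finite,linorder} \<Rightarrow> (complex ^ 's::{finite,linorder} \<Rightarrow> complex) \<Rightarrow> complex" where
  "apply_functional c x g = (\<Sum>j | c j \<noteq> 0. c j * pdiff j x g)"

text \<open>The differential order; the zero functional is given order 0.\<close>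

definition diff_order :: "(('s::finite \<Rightarrow> nat) \<Rightarrow> complex) \<Rightarrow> nat" where
  "diff_order c = Max (insert 0 (mdeg ` {j. c j \<noteq> 0}))"

text \<open>\<open>\<phi>\<^sub>i\<close> sends \<open>\<partial>\<^sub>j\<close> to \<open>\<partial>\<^bsub>j - e\<^sub>i\<^esub>\<close> (and to 0 if \<open>j\<^sub>i = 0\<close>), so the coefficient of \<open>\<partial>\<^sub>j\<close>
  in \<open>\<phi>\<^sub>i(c)\<close> is that of \<open>\<partial>\<^bsub>j + e\<^sub>i\<^esub>\<close> in \<open>c\<close>.\<close>

definition antidiff :: "'s \<Rightarrow> (('s \<Rightarrow> nat) \<Rightarrow> complex) \<Rightarrow> ('s \<Rightarrow> nat) \<Rightarrow> complex" where
  "antidiff i c = (\<lambda>j. c (j(i := j i + 1)))"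

primrec dual_upto ::
  "(complex ^ 's::{finite,linorder} \<Rightarrow> complex ^ 't) \<Rightarrow> complex ^ 's::{finite,linorder} \<Rightarrow> nat \<Rightarrow> (('s \<Rightarrow> nat) \<Rightarrow> complex) set" where
  "dual_upto f x 0 = {c. \<forall>j. j \<noteq> (\<lambda>_. 0) \<longrightarrow> c j = 0}"
| "dual_upto f x (Suc \<alpha>) = {c. (\<forall>j. c j \<noteq> 0 \<longrightarrow> mdeg j \<le> Suc \<alpha>) \<and>
     (\<forall>l. apply_functional c x (\<lambda>y. f y $ l) = 0) \<and> (\<forall>i. antidiff i c \<in> dual_upto f x \<alpha>)}"

definition dual_space ::
  "(complex ^ 's::{finite,linorder} \<Rightarrow> complex ^ 't) \<Rightarrow> complex ^ 's::{finite,linorder} \<Rightarrow> (('s \<Rightarrow> nat) \<Rightarrow> complex) set" where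
  "dual_space f x = (\<Union>\<alpha>. dual_upto f x \<alpha>)"

definition has_depth :: "(complex ^ 's::{finite,linorder} \<Rightarrow> complex ^ 't) \<Rightarrow> complex ^ 's::{finite,linorder} \<Rightarrow> nat \<Rightarrow> bool" where
  "has_depth f x \<delta> \<longleftrightarrow>
     (\<exists>c\<in>dual_space f x. diff_order c = \<delta>) \<and> (\<forall>c\<in>dual_space f x. diff_order c \<le> \<delta>)"


section \<open>Systems in several blocks of variables\<close>

text \<open>The number of variables changes along the process, so a point with \<open>n\<close> blocks
  \<open>(x\<^sub>1, \<dots>, x\<^sub>n)\<close> of \<open>s\<close> variables is a sequence of blocks \<open>nat \<Rightarrow> complex ^ 's\<close> vanishing from
  index \<open>n\<close> on. Blocks are numbered from 0: block \<open>k\<close> is the vector \<open>x\<^bsub>k+1\<^esub>\<close>. A system is the list of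
  its equations; a matrix with \<open>n\<close> blocks of columns is the list of its rows (of which only the
  blocks below \<open>n\<close> are used), so that stacking matrices is appending lists.\<close>

type_synonym 's blocks = "nat \<Rightarrow> complex ^ 's"

definition block_vecs :: "nat \<Rightarrow> 's::finite blocks set" where
  "block_vecs n = {X. \<forall>k\<ge>n. X k = 0}"

definition row_mult :: "nat \<Rightarrow> 's::finite blocks \<Rightarrow> 's blocks \<Rightarrow> complex" where
  "row_mult n r Y = (\<Sum>k<n. \<Sum>i\<in>UNIV. r k $ i * Y k $ i)"

definition mat_mult :: "nat \<Rightarrow> 's::finite blocks list \<Rightarrow> 's blocks \<Rightarrow> complex list" where
  "mat_mult n A Y = map (\<lambda>r. row_mult n r Y) A"

definition full_column_rank :: "nat \<Rightarrow> 's::finite blocks list \<Rightarrow> bool" where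
  "full_column_rank n A \<longleftrightarrow> inj_on (mat_mult n A) (block_vecs n)"

definition scale_blocks :: "complex \<Rightarrow> 's::finite blocks \<Rightarrow> 's blocks" where
  "scale_blocks a Y = (\<lambda>k. a *s Y k)"

definition nullity :: "nat \<Rightarrow> 's::finite blocks list \<Rightarrow> nat" where
  "nullity n A = vector_space.dim scale_blocks {Y \<in> block_vecs n. \<forall>r\<in>set A. row_mult n r Y = 0}"

definition block_partial :: "nat \<Rightarrow> 's::finite \<Rightarrow> ('s blocks \<Rightarrow> complex) \<Rightarrow> 's blocks \<Rightarrow> complex" where
  "block_partial k i F X = partial i (\<lambda>y. F (X(k := y))) (X k)"

definition gradient :: "('s::finite blocks \<Rightarrow> complex) \<Rightarrow> 's blocks \<Rightarrow> 's blocks" where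
  "gradient F X = (\<lambda>k. \<chi> i. block_partial k i F X)"

definition jacobian :: "('s::finite blocks \<Rightarrow> complex) list \<Rightarrow> 's blocks \<Rightarrow> 's blocks list" where
  "jacobian Fs X = map (\<lambda>F. gradient F X) Fs"

definition zeros :: "nat \<Rightarrow> ('s::finite blocks \<Rightarrow> complex) list \<Rightarrow> 's blocks set" where
  "zeros n Fs = {X \<in> block_vecs n. \<forall>F\<in>set Fs. F X = 0}"

definition simple_zero :: "nat \<Rightarrow> ('s::finite blocks \<Rightarrow> complex) list \<Rightarrow> 's blocks \<Rightarrow> bool" where
  "simple_zero n Fs X \<longleftrightarrow> X \<in> zeros n Fs \<and> full_column_rank n (jacobian Fs X)"

definition multiple_zero :: "nat \<Rightarrow> ('s::finite blocks \<Rightarrow> complex) list \<Rightarrow> 's blocks \<Rightarrow> bool" where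
  "multiple_zero n Fs X \<longleftrightarrow> X \<in> zeros n Fs \<and> \<not> full_column_rank n (jacobian Fs X)"


section \<open>The depth-deflation process\<close>

definition unit_first :: "nat \<Rightarrow> complex list" where
  "unit_first m = map (\<lambda>r. if r = 0 then 1 else 0) [0..<m]"

text \<open>The equations \<open>F = 0\<close>, \<open>J y = 0\<close> and \<open>R y = e\<^sub>1\<close>, where \<open>y\<close> consists of the blocks
  \<open>n, \<dots>, 2 n - 1\<close>.\<close>

definition expand_system ::
  "nat \<Rightarrow> ('s::finite blocks \<Rightarrow> complex) list \<Rightarrow> 's blocks list \<Rightarrow> ('s blocks \<Rightarrow> complex) list" where
  "expand_system n Fs A =
     Fs
     @ map (\<lambda>F X. row_mult n (gradient F X) (\<lambda>k. X (n + k))) Fs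
     @ map (\<lambda>r X. row_mult n (A ! r) (\<lambda>k. X (n + k)) - unit_first (length A) ! r) [0..<length A]"

text \<open>\<open>R (Suc \<alpha>)\<close> is the matrix selected in passing from \<open>f\<^sub>\<alpha>\<close> to \<open>f\<^bsub>\<alpha>+1\<^esub>\<close>; \<open>R 0\<close> is not used.\<close>

primrec deflated_system ::
  "(complex ^ 's \<Rightarrow> complex ^ 't::{finite,linorder}) \<Rightarrow> (nat \<Rightarrow> 's::finite blocks list) \<Rightarrow> nat
     \<Rightarrow> ('s blocks \<Rightarrow> complex) list" where
  "deflated_system f R 0 = map (\<lambda>l X. f (X 0) $ l) (sorted_list_of_set UNIV)"
| "deflated_system f R (Suc \<alpha>) = expand_system (2 ^ \<alpha>) (deflated_system f R \<alpha>) (R (Suc \<alpha>))"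

primrec deflated_zero ::
  "(complex ^ 's \<Rightarrow> complex ^ 't::{finite,linorder}) \<Rightarrow> complex ^ 's \<Rightarrow> (nat \<Rightarrow> 's::finite blocks list) \<Rightarrow> nat
     \<Rightarrow> 's blocks" where
  "deflated_zero f x R 0 = (\<lambda>k. if k = 0 then x else 0)"
| "deflated_zero f x R (Suc \<alpha>) =
     (let X = deflated_zero f x R \<alpha>;
          J = jacobian (deflated_system f R \<alpha>) X;
          Y = (THE Y. Y \<in> block_vecs (2 ^ \<alpha>) \<and>
                 mat_mult (2 ^ \<alpha>) (J @ R (Suc \<alpha>)) Y
                   = replicate (length J) 0 @ unit_first (length (R (Suc \<alpha>))))
      in (\<lambda>k. if k < 2 ^ \<alpha> then X k else Y (k - 2 ^ \<alpha>)))"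

text \<open>The requirement on the selected matrices, imposed at every step that the process performs.\<close>

definition admissible ::
  "(complex ^ 's \<Rightarrow> complex ^ 't::{finite,linorder}) \<Rightarrow> complex ^ 's \<Rightarrow> (nat \<Rightarrow> 's::finite blocks list) \<Rightarrow> bool" where
  "admissible f x R \<longleftrightarrow>
     (\<forall>\<alpha>. (\<forall>\<beta>\<le>\<alpha>. multiple_zero (2 ^ \<beta>) (deflated_system f R \<beta>) (deflated_zero f x R \<beta>)) \<longrightarrow>
       (let J = jacobian (deflated_system f R \<alpha>) (deflated_zero f x R \<alpha>)
        in length (R (Suc \<alpha>)) = nullity (2 ^ \<alpha>) J \<and> full_column_rank (2 ^ \<alpha>) (J @ R (Suc \<alpha>))))"

definition terminates_at ::
  "(complex ^ 's \<Rightarrow> complex ^ 't::{finite,linorder}) \<Rightarrow> complex ^ 's \<Rightarrow> (nat \<Rightarrow> 's::finite blocks list) \<Rightarrow> nat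
     \<Rightarrow> bool" where
  "terminates_at f x R \<sigma> \<longleftrightarrow>
     (\<forall>\<alpha><\<sigma>. multiple_zero (2 ^ \<alpha>) (deflated_system f R \<alpha>) (deflated_zero f x R \<alpha>)) \<and>
     simple_zero (2 ^ \<sigma>) (deflated_system f R \<sigma>) (deflated_zero f x R \<sigma>)"


section \<open>The functionals generated\<close>

definition Phi :: "nat \<Rightarrow> ('s::finite blocks \<Rightarrow> complex) \<Rightarrow> 's blocks \<Rightarrow> complex" where
  "Phi \<mu> F X = (\<Sum>\<zeta><2 ^ (\<mu> - 1). \<Sum>i\<in>UNIV. X (2 ^ (\<mu> - 1) + \<zeta>) $ i * block_partial \<zeta> i F X)"

text \<open>The smallest element of \<open>M\<close> is applied first. The functional is evaluated at
  \<open>X = deflated_zero f x R \<sigma>\<close>.\<close>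

definition generated_functional ::
  "nat set \<Rightarrow> 's::finite blocks \<Rightarrow> (complex ^ 's \<Rightarrow> complex) \<Rightarrow> complex" where
  "generated_functional M X g = fold Phi (sorted_list_of_set M) (\<lambda>X. g (X 0)) X"

end

theory Submission
  imports Defs
begin

text \<open>The idea is to read a point \<open>(x\<^sub>1, \<dots>, x\<^bsub>2^\<sigma>\<^esub>)\<close> as a curve in nilpotent parameters. Take
  \<open>\<epsilon>\<^sub>1, \<dots>, \<epsilon>\<^sub>\<sigma>\<close> with \<open>\<epsilon>\<^sub>\<mu>\<^sup>2 = 0\<close>, write \<open>\<epsilon>\<^bsup>N\<^esup>\<close> for the product of the \<open>\<epsilon>\<^sub>\<mu>\<close> with \<open>\<mu> \<in> N\<close>, number the
  subsets \<open>N\<close> of \<open>{1..\<sigma>}\<close> in binary, and put \<open>X(\<epsilon>) = \<Sum>\<^bsub>N\<^esub> X\<^bsub>N\<^esub> \<epsilon>\<^bsup>N\<^esup>\<close>, so that \<open>X(0)\<close> is the first block.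
  The operator \<open>\<Phi>\<^sub>\<mu>\<close> replaces each block \<open>X\<^bsub>N\<^esub>\<close> by \<open>X\<^bsub>N \<union> {\<mu>}\<^esub>\<close>, one at a time and linearly: it takes the
  coefficient of \<open>\<epsilon>\<^sub>\<mu>\<close>. Hence the functional generated by \<open>M\<close> sends \<open>g\<close> to the coefficient of \<open>\<epsilon>\<^bsup>M\<^esup>\<close> in
  \<open>g(X(\<epsilon>))\<close> (\<open>fold_Phi_eq_taylor_coeff\<close>), and the equations of the \<open>\<sigma>\<close>-th deflated system contain
  the vanishing of all these coefficients for the components of \<open>f\<close>
  (\<open>fold_Phi_in_deflated_system\<close>).

  Expanding \<open>g\<close> around the first block, this coefficient is a differential functional whose
  coefficient at \<open>\<partial>\<^sub>j\<close> is that of \<open>\<epsilon>\<^bsup>M\<^esup>\<close> in \<open>h\<^sup>j\<close>, where \<open>h = X(\<epsilon>) - X(0)\<close>. Applying \<open>\<phi>\<^sub>i\<close> amounts to one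
  more factor \<open>h\<^sub>i\<close>, so \<open>\<phi>\<^sub>i\<close> maps the functional of \<open>M\<close> into the span of the functionals of proper
  subsets of \<open>M\<close> (\<open>antidiff_taylor_functional\<close>). All of them annihilate \<open>f\<close> at a zero of the deflated
  system, and induction on the size of \<open>M\<close> puts them into the dual space.

  For the bound on the number of steps, let the first \<open>\<sigma>\<close> zeros all be multiple. The part of order
  \<open>\<sigma>\<close> of the functional of \<open>{1..\<sigma>}\<close> is a product of \<open>\<sigma>\<close> linear forms, one for each vector
  \<open>X\<^bsub>{\<mu>}\<^esub>\<close> (\<open>top_form_taylor_functional\<close>). These vectors are the first blocks of the solutions of the
  linear systems. They do not vanish: the Jacobian of an expanded system is block triangular, and so a
  kernel vector whose first half vanishes has its second half in the kernel of an injective matrix;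
  inductively, a vanishing first block is enough (\<open>kernel_first_block\<close>). A product of nonzero linear forms is not zero, so a functional
  of order \<open>\<sigma>\<close> lies in the dual space, and \<open>\<sigma>\<close> is at most the depth.

  The zeros stay isolated for a simple reason: near \<open>x\<close> the first block of a zero must be \<open>x\<close>, and every
  further half of the blocks is then the only solution of a linear system
  (\<open>zero_near_unique\<close>).\<close>

section \<open>Iterated partial derivatives\<close>

lemma coord_upd_same [simp]: "coord_upd y i (y $ i) = y"
  by (simp add: coord_upd_def vec_eq_iff)

lemma coord_upd_nth [simp]: "coord_upd y i z $ j = (if j = i then z else y $ j)"
  by (simp add: coord_upd_def)

lemma coord_upd_twice [simp]: "coord_upd (coord_upd y i z) i z' = coord_upd y i z'"
  by (simp add: coord_upd_def vec_eq_iff)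

lemma coord_upd_commute:
  "i \<noteq> j \<Longrightarrow> coord_upd (coord_upd y i u) j v = coord_upd (coord_upd y j v) i u"
  by (simp add: coord_upd_def vec_eq_iff)

lemma continuous_on_coord_upd [continuous_intros]:
  assumes "continuous_on S y" "continuous_on S z"
  shows "continuous_on S (\<lambda>t. coord_upd (y t) i (z t))"
  unfolding coord_upd_def
proof (rule continuous_on_vec_lambda)
  fix j
  show "continuous_on S (\<lambda>t. if j = i then z t else y t $ j)"
    using assms by (cases "j = i") (auto intro!: continuous_intros)
qed

lemma eventually_coord_upd:
  assumes "open U" "y \<in> U"
  shows "\<forall>\<^sub>F z in nhds (y $ i). coord_upd y i z \<in> U"
proof -
  have "open ((\<lambda>z. coord_upd y i z) -` U)"
    by (intro open_vimage assms(1) continuous_intros)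
  then have "\<forall>\<^sub>F z in nhds (y $ i). z \<in> (\<lambda>z. coord_upd y i z) -` U"
    using assms(2) by (intro eventually_nhds_in_open) auto
  then show ?thesis by simp
qed

text \<open>A fixed open set makes differentiation at all points of a neighbourhood available, and passes
  unchanged from a function to its partial derivatives.\<close>

definition smooth_on :: "(complex ^ 's::finite) set \<Rightarrow> (complex ^ 's \<Rightarrow> complex) \<Rightarrow> bool" where
  "smooth_on U g \<longleftrightarrow> open U \<and> (\<forall>ds. continuous_on U (partials ds g) \<and>
     (\<forall>i. \<forall>y\<in>U. (\<lambda>z. partials ds g (coord_upd y i z)) field_differentiable at (y $ i)))"

lemma smooth_near_iff_smooth_on: "smooth_near x g \<longleftrightarrow> (\<exists>U. x \<in> U \<and> smooth_on U g)"
  unfolding smooth_near_def smooth_on_def by blast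

lemma partials_simps [simp]:
  "partials [] g = g"
  "partials (i # ds) g = partial i (partials ds g)"
  "partials (ds @ es) g = partials ds (partials es g)"
  by (simp_all add: partials_def)

lemma smooth_on_partials:
  assumes "smooth_on U g"
  shows "smooth_on U (partials es g)"
  using assms unfolding smooth_on_def by (metis partials_simps(3))

lemma smooth_on_partial:
  assumes "smooth_on U g"
  shows "smooth_on U (partial i g)"
  using smooth_on_partials[OF assms, of "[i]"] by simp

lemma smooth_on_open: "smooth_on U g \<Longrightarrow> open U"
  by (simp add: smooth_on_def)

lemma smooth_on_has_partial:
  assumes "smooth_on U g" "y \<in> U"
  shows "((\<lambda>z. g (coord_upd y i z)) has_field_derivative partial i g y) (at (y $ i))"
proof -
  have "(\<lambda>z. partials [] g (coord_upd y i z)) field_differentiable at (y $ i)"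
    using assms unfolding smooth_on_def by blast
  then show ?thesis
    by (simp add: partial_def field_differentiable_derivI)
qed

lemma smooth_on_continuous: "smooth_on U g \<Longrightarrow> continuous_on U g"
  unfolding smooth_on_def by (metis partials_simps(1))

lemma partial_cong_on:
  assumes "open U" "y \<in> U" "\<And>y. y \<in> U \<Longrightarrow> g y = h y"
  shows "partial i g y = partial i h y"
  unfolding partial_def
proof (rule deriv_cong_ev)
  show "\<forall>\<^sub>F z in nhds (y $ i). g (coord_upd y i z) = h (coord_upd y i z)"
    using eventually_coord_upd[OF assms(1,2)] by eventually_elim (rule assms(3))
qed simp

text \<open>The mean value inequality, applied first to \<open>v \<mapsto> \<phi>1 u v - v L\<close> and then to
  \<open>u \<mapsto> \<phi> u (b + k) - \<phi> u b - u k L\<close>. The quantity on the left is symmetric in the two variables, which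
  is what makes mixed derivatives agree.\<close>

lemma second_difference_bound:
  fixes \<phi> \<phi>1 \<phi>12 :: "complex \<Rightarrow> complex \<Rightarrow> complex"
  assumes d1: "\<And>u v. u \<in> ball a r \<Longrightarrow> v \<in> ball b r \<Longrightarrow>
      ((\<lambda>u. \<phi> u v) has_field_derivative \<phi>1 u v) (at u)"
    and d12: "\<And>u v. u \<in> ball a r \<Longrightarrow> v \<in> ball b r \<Longrightarrow>
      ((\<lambda>v. \<phi>1 u v) has_field_derivative \<phi>12 u v) (at v)"
    and bd: "\<And>u v. u \<in> ball a r \<Longrightarrow> v \<in> ball b r \<Longrightarrow> norm (\<phi>12 u v - L) \<le> e"
    and h: "h \<in> ball 0 r" and k: "k \<in> ball 0 r"
  shows "norm (\<phi> (a + h) (b + k) - \<phi> (a + h) b - \<phi> a (b + k) + \<phi> a b - h * k * L)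
     \<le> e * norm k * norm h"
proof -
  have r: "0 < r" using h norm_ge_zero[of h] by (simp del: norm_ge_zero)
  have bk: "b + k \<in> ball b r" "b \<in> ball b r" "a + h \<in> ball a r" "a \<in> ball a r"
    using h k r by (auto simp: dist_norm)
  have inner: "norm (\<phi>1 u (b + k) - \<phi>1 u b - k * L) \<le> e * norm k" if u: "u \<in> ball a r" for u
  proof -
    have "norm ((\<phi>1 u (b + k) - (b + k) * L) - (\<phi>1 u b - b * L)) \<le> e * norm ((b + k) - b)"
    proof (rule field_differentiable_bound[where S = "ball b r" and f' = "\<lambda>v. \<phi>12 u v - L"])
      fix v assume v: "v \<in> ball b r"
      show "((\<lambda>v. \<phi>1 u v - v * L) has_field_derivative \<phi>12 u v - L) (at v within ball b r)"
        using d12[OF u v] by (auto intro!: derivative_eq_intros intro: has_field_derivative_at_within)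
      show "norm (\<phi>12 u v - L) \<le> e" using bd u v by blast
    qed (use bk in auto)
    then show ?thesis by (simp add: algebra_simps)
  qed
  have "norm ((\<phi> (a + h) (b + k) - \<phi> (a + h) b - (a + h) * (k * L)) - (\<phi> a (b + k) - \<phi> a b - a * (k * L)))
     \<le> e * norm k * norm ((a + h) - a)"
  proof (rule field_differentiable_bound[where S = "ball a r" and f' = "\<lambda>u. \<phi>1 u (b + k) - \<phi>1 u b - k * L"])
    fix u assume u: "u \<in> ball a r"
    show "((\<lambda>u. \<phi> u (b + k) - \<phi> u b - u * (k * L)) has_field_derivative \<phi>1 u (b + k) - \<phi>1 u b - k * L)
        (at u within ball a r)"
      using d1[OF u bk(1)] d1[OF u bk(2)]
      by (auto intro!: derivative_eq_intros intro: has_field_derivative_at_within)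
    show "norm (\<phi>1 u (b + k) - \<phi>1 u b - k * L) \<le> e * norm k" using inner[OF u] .
  qed (use bk in auto)
  then show ?thesis by (simp add: algebra_simps)
qed

text \<open>Schwarz's theorem for functions of two complex variables: both mixed derivatives are the limit of
  the same second difference divided by \<open>h\<^sup>2\<close>.\<close>

lemma mixed_derivatives_eq:
  fixes \<phi> \<phi>1 \<phi>2 \<phi>12 \<phi>21 :: "complex \<Rightarrow> complex \<Rightarrow> complex"
  assumes r: "0 < r"
    and d1: "\<And>u v. u \<in> ball a r \<Longrightarrow> v \<in> ball b r \<Longrightarrow>
      ((\<lambda>u. \<phi> u v) has_field_derivative \<phi>1 u v) (at u)"
    and d2: "\<And>u v. u \<in> ball a r \<Longrightarrow> v \<in> ball b r \<Longrightarrow>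
      ((\<lambda>v. \<phi> u v) has_field_derivative \<phi>2 u v) (at v)"
    and d12: "\<And>u v. u \<in> ball a r \<Longrightarrow> v \<in> ball b r \<Longrightarrow>
      ((\<lambda>v. \<phi>1 u v) has_field_derivative \<phi>12 u v) (at v)"
    and d21: "\<And>u v. u \<in> ball a r \<Longrightarrow> v \<in> ball b r \<Longrightarrow>
      ((\<lambda>u. \<phi>2 u v) has_field_derivative \<phi>21 u v) (at u)"
    and c12: "\<And>e. 0 < e \<Longrightarrow> \<exists>d>0. \<forall>u\<in>ball a d. \<forall>v\<in>ball b d. norm (\<phi>12 u v - \<phi>12 a b) \<le> e"
    and c21: "\<And>e. 0 < e \<Longrightarrow> \<exists>d>0. \<forall>u\<in>ball a d. \<forall>v\<in>ball b d. norm (\<phi>21 u v - \<phi>21 a b) \<le> e"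
  shows "\<phi>12 a b = \<phi>21 a b"
proof (rule ccontr)
  assume "\<phi>12 a b \<noteq> \<phi>21 a b"
  define e where "e = norm (\<phi>12 a b - \<phi>21 a b) / 3"
  have e: "0 < e" using \<open>\<phi>12 a b \<noteq> \<phi>21 a b\<close> by (simp add: e_def)
  obtain d where d: "0 < d" "\<And>u v. u \<in> ball a d \<Longrightarrow> v \<in> ball b d \<Longrightarrow> norm (\<phi>12 u v - \<phi>12 a b) \<le> e"
    using c12[OF e] by blast
  obtain d' where d': "0 < d'" "\<And>u v. u \<in> ball a d' \<Longrightarrow> v \<in> ball b d' \<Longrightarrow> norm (\<phi>21 u v - \<phi>21 a b) \<le> e"
    using c21[OF e] by blast
  define q where "q = min r (min d d')"
  have q: "0 < q" "q \<le> r" "q \<le> d" "q \<le> d'" using r d(1) d'(1) by (auto simp: q_def)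
  \<comment> \<open>Any nonzero step inside the common radius will do for both increments.\<close>
  define h where "h = complex_of_real (q / 2)"
  have h: "h \<in> ball 0 q" "h \<noteq> 0" using q(1) by (auto simp: h_def norm_divide)
  define \<Delta> where "\<Delta> = \<phi> (a + h) (b + h) - \<phi> (a + h) b - \<phi> a (b + h) + \<phi> a b"
  have "norm (\<Delta> - h * h * \<phi>12 a b) \<le> e * norm h * norm h"
    unfolding \<Delta>_def
    by (rule second_difference_bound[where r = q and ?\<phi>1.0 = \<phi>1 and ?\<phi>12.0 = \<phi>12])
       (use h q d1 d12 d(2) in auto)
  moreover have "norm (\<phi> (a + h) (b + h) - \<phi> a (b + h) - \<phi> (a + h) b + \<phi> a b - h * h * \<phi>21 a b)
      \<le> e * norm h * norm h"
    by (rule second_difference_bound[where r = q and \<phi> = "\<lambda>v u. \<phi> u v"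
          and ?\<phi>1.0 = "\<lambda>v u. \<phi>2 u v" and ?\<phi>12.0 = "\<lambda>v u. \<phi>21 u v"])
       (use h q d2 d21 d'(2) in auto)
  then have "norm (\<Delta> - h * h * \<phi>21 a b) \<le> e * norm h * norm h"
    by (simp add: \<Delta>_def algebra_simps)
  ultimately have "norm ((\<Delta> - h * h * \<phi>21 a b) - (\<Delta> - h * h * \<phi>12 a b)) \<le> 2 * (e * norm h * norm h)"
    using norm_triangle_ineq4[of "\<Delta> - h * h * \<phi>21 a b" "\<Delta> - h * h * \<phi>12 a b"] by linarith
  moreover have "(\<Delta> - h * h * \<phi>21 a b) - (\<Delta> - h * h * \<phi>12 a b) = h * h * (\<phi>12 a b - \<phi>21 a b)"
    by (simp add: algebra_simps)
  ultimately have "norm h * norm h * (3 * e) \<le> 2 * (e * norm h * norm h)"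
    by (simp add: norm_mult e_def)
  moreover have "0 < norm h * norm h * e" using h e by simp
  ultimately show False by (simp add: algebra_simps)
qed

lemma partial_commute:
  assumes g: "smooth_on U g" and y: "y \<in> U"
  shows "partial i (partial j g) y = partial j (partial i g) y"
proof (cases "i = j")
  case False
  define pt where "pt = (\<lambda>u v. coord_upd (coord_upd y j u) i v)"
  have pt_alt: "pt u v = coord_upd (coord_upd y i v) j u" for u v
    using False by (simp add: pt_def coord_upd_commute)
  have pt0: "pt (y $ j) (y $ i) = y" by (simp add: pt_def)
  have cont_pt: "continuous_on UNIV (\<lambda>p. pt (fst p) (snd p))"
    unfolding pt_def by (intro continuous_intros)
  have "open ((\<lambda>p. pt (fst p) (snd p)) -` U)"
    by (intro open_vimage cont_pt smooth_on_open[OF g])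
  moreover have "(y $ j, y $ i) \<in> (\<lambda>p. pt (fst p) (snd p)) -` U"
    using y by (simp add: pt0)
  ultimately obtain A B where AB: "open A" "open B" "(y $ j, y $ i) \<in> A \<times> B"
      "A \<times> B \<subseteq> (\<lambda>p. pt (fst p) (snd p)) -` U"
    by (rule open_prod_elim)
  obtain r1 r2 where r12: "0 < r1" "ball (y $ j) r1 \<subseteq> A" "0 < r2" "ball (y $ i) r2 \<subseteq> B"
    using AB by (metis mem_Sigma_iff open_contains_ball)
  define r where "r = min r1 r2"
  have r: "0 < r" using r12 by (simp add: r_def)
  have inU: "pt u v \<in> U" if "u \<in> ball (y $ j) r" "v \<in> ball (y $ i) r" for u v
  proof -
    have "u \<in> A" "v \<in> B" using that r12 by (auto simp: r_def subset_iff)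
    then show ?thesis using AB(4) by auto
  qed
  have dj: "((\<lambda>u. h (pt u v)) has_field_derivative partial j h (pt u v)) (at u)"
    if "smooth_on U h" "u \<in> ball (y $ j) r" "v \<in> ball (y $ i) r" for h u v
    using smooth_on_has_partial[OF that(1) inU[OF that(2,3)], of j] by (simp add: pt_alt)
  have di: "((\<lambda>v. h (pt u v)) has_field_derivative partial i h (pt u v)) (at v)"
    if "smooth_on U h" "u \<in> ball (y $ j) r" "v \<in> ball (y $ i) r" for h u v
    using smooth_on_has_partial[OF that(1) inU[OF that(2,3)], of i] by (simp add: pt_def)
  have cont: "\<exists>d>0. \<forall>u\<in>ball (y $ j) d. \<forall>v\<in>ball (y $ i) d.
      norm (h (pt u v) - h (pt (y $ j) (y $ i))) \<le> e"
    if h: "smooth_on U h" and e: "0 < e" for h e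
  proof -
    let ?S = "ball (y $ j) r \<times> ball (y $ i) r"
    have "continuous_on ?S (\<lambda>p. h (pt (fst p) (snd p)))"
      by (rule continuous_on_compose2[OF smooth_on_continuous[OF h]
            continuous_on_subset[OF cont_pt]]) (auto intro: inU)
    moreover have "open ?S" by (intro open_Times) auto
    ultimately have "isCont (\<lambda>p. h (pt (fst p) (snd p))) (y $ j, y $ i)"
      using r by (simp add: continuous_on_eq_continuous_at)
    then obtain d where d: "0 < d"
      "\<And>p. dist p (y $ j, y $ i) < d \<Longrightarrow> dist (h (pt (fst p) (snd p))) (h (pt (y $ j) (y $ i))) < e"
      using e unfolding continuous_at_eps_delta by (metis fst_conv snd_conv)
    have "norm (h (pt u v) - h (pt (y $ j) (y $ i))) \<le> e"
      if u: "u \<in> ball (y $ j) (d / 2)" and v: "v \<in> ball (y $ i) (d / 2)" for u v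
    proof -
      have "dist (u, v) (y $ j, y $ i) \<le> dist u (y $ j) + dist v (y $ i)"
        by (simp add: dist_Pair_Pair sqrt_sum_squares_le_sum)
      also have "\<dots> < d" using u v by (simp add: dist_commute)
      finally show ?thesis using d(2)[of "(u, v)"] by (simp add: dist_norm)
    qed
    then show ?thesis using d(1) by (intro exI[of _ "d / 2"]) auto
  qed
  have "partial i (partial j g) (pt (y $ j) (y $ i)) = partial j (partial i g) (pt (y $ j) (y $ i))"
    by (rule mixed_derivatives_eq[where \<phi> = "\<lambda>u v. g (pt u v)" and r = r
          and ?\<phi>1.0 = "\<lambda>u v. partial j g (pt u v)" and ?\<phi>2.0 = "\<lambda>u v. partial i g (pt u v)"
          and ?\<phi>12.0 = "\<lambda>u v. partial i (partial j g) (pt u v)"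
          and ?\<phi>21.0 = "\<lambda>u v. partial j (partial i g) (pt u v)"])
       (intro r di dj cont smooth_on_partial g; assumption)+
  then show ?thesis by (simp add: pt0)
qed simp

lemma partials_move:
  assumes "smooth_on U g" "y \<in> U"
  shows "partials ds (partial i g) y = partial i (partials ds g) y"
  using assms(2)
proof (induction ds arbitrary: y)
  case (Cons j ds)
  have "partial j (partials ds (partial i g)) y = partial j (partial i (partials ds g)) y"
    by (rule partial_cong_on[OF smooth_on_open[OF assms(1)]]) (use Cons in auto)
  also have "\<dots> = partial i (partial j (partials ds g)) y"
    by (rule partial_commute[OF smooth_on_partials[OF assms(1)] Cons.prems])
  finally show ?case by simp
qed simp

text \<open>Every order of differentiation gives the same value. This is needed because \<open>\<partial>\<^sub>j\<close> differentiates in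
  a fixed order of the coordinates, while the operators \<open>\<Phi>\<^sub>\<mu>\<close> differentiate in all orders.\<close>

lemma partials_mset_cong:
  assumes "smooth_on U g" "mset ds = mset es" "y \<in> U"
  shows "partials ds g y = partials es g y"
  using assms(2,3)
proof (induction ds arbitrary: es y)
  case (Cons i ds)
  then have "i \<in> set es" by (metis list.set_intros(1) mset_eq_setD)
  then obtain us vs where es: "es = us @ i # vs" by (meson split_list)
  have "mset ds = mset (us @ vs)" using Cons.prems(1) by (simp add: es)
  then have "partial i (partials ds g) y = partial i (partials (us @ vs) g) y"
    by (intro partial_cong_on[OF smooth_on_open[OF assms(1)] Cons.prems(2)] Cons.IH)
  also have "\<dots> = partials es g y"
    using partials_move[OF smooth_on_partials[OF assms(1)] Cons.prems(2), of us i vs] by (simp add: es)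
  finally show ?case by simp
qed simp

section \<open>Coefficient families of differential functionals\<close>

lemma pdiff_partials:
  "pdiff j x g = partials (concat (map (\<lambda>i. replicate (j i) i) (sorted_list_of_set UNIV))) g x
     / (\<Prod>i\<in>UNIV. fact (j i))"
proof -
  have pow: "(partial i ^^ n) h = partials (replicate n i) h" for i n and h :: "complex ^ 's \<Rightarrow> complex"
    by (induction n) auto
  have "foldr (\<lambda>i. partial i ^^ j i) L g = partials (concat (map (\<lambda>i. replicate (j i) i) L)) g" for L
    by (induction L) (auto simp: pow)
  then show ?thesis by (simp add: pdiff_def)
qed

lemma mset_concat_replicate:
  fixes j :: "'s::{finite,linorder} \<Rightarrow> nat"
  shows "mset (concat (map (\<lambda>i. replicate (j i) i) (sorted_list_of_set UNIV)))
    = (\<Sum>i\<in>UNIV. replicate_mset (j i) i)"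
proof -
  have "mset (concat (map (\<lambda>i. replicate (j i) i) L)) = (\<Sum>i\<in>set L. replicate_mset (j i) i)"
    if "distinct L" for L
    using that by (induction L) auto
  from this[of "sorted_list_of_set UNIV"] show ?thesis by simp
qed

text \<open>The factor \<open>j\<^sub>i + 1\<close> comes from the factorials in \<open>\<partial>\<^sub>j\<close>.\<close>

lemma pdiff_incr:
  assumes "smooth_on U g" "x \<in> U"
  shows "of_nat (j i + 1) * pdiff (j(i := j i + 1)) x g = pdiff j x (partial i g)"
proof -
  let ?w = "\<lambda>j. concat (map (\<lambda>i. replicate (j i) i) (sorted_list_of_set UNIV))"
  let ?j = "j(i := j i + 1)"
  have "(\<Sum>l\<in>UNIV. replicate_mset (?j l) l)
      = replicate_mset (j i + 1) i + (\<Sum>l\<in>UNIV - {i}. replicate_mset (j l) l)"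
    by (subst sum.remove[of _ i]) auto
  also have "\<dots> = {#i#} + (\<Sum>l\<in>UNIV. replicate_mset (j l) l)"
    by (subst (2) sum.remove[of _ i]) auto
  finally have "mset (?w ?j) = {#i#} + mset (?w j)"
    unfolding mset_concat_replicate .
  moreover have "mset (?w j @ [i]) = {#i#} + mset (?w j)"
    by (simp only: mset_append mset.simps add.commute)
  ultimately have "mset (?w ?j) = mset (?w j @ [i])" by (simp only:)
  from partials_mset_cong[OF assms(1) this assms(2)]
  have w: "partials (?w ?j) g x = partials (?w j) (partial i g) x"
    by (simp only: partials_simps)
  have "(\<Prod>l\<in>UNIV. fact (?j l)) = fact (j i + 1) * (\<Prod>l\<in>UNIV - {i}. fact (j l) :: complex)"
    by (subst prod.remove[of _ i]) auto
  also have "\<dots> = of_nat (j i + 1) * (\<Prod>l\<in>UNIV. fact (j l))"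
    by (subst (2) prod.remove[of _ i]) auto
  finally have f: "(\<Prod>l\<in>UNIV. fact (?j l) :: complex) = of_nat (j i + 1) * (\<Prod>l\<in>UNIV. fact (j l))" .
  have "(of_nat (j i + 1) :: complex) \<noteq> 0"
    using of_nat_neq_0[of "j i", where ?'a = complex] by simp
  then show ?thesis
    unfolding pdiff_partials w f by simp
qed

lemma finite_mdeg_le: "finite {j :: 's::finite \<Rightarrow> nat. mdeg j \<le> n}"
proof (rule finite_subset)
  show "{j :: 's \<Rightarrow> nat. mdeg j \<le> n} \<subseteq> PiE UNIV (\<lambda>_. {..n})"
  proof
    fix j :: "'s \<Rightarrow> nat" assume "j \<in> {j. mdeg j \<le> n}"
    moreover have "j i \<le> mdeg j" for i unfolding mdeg_def by (rule member_le_sum) auto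
    ultimately have "j i \<le> n" for i by (metis mem_Collect_eq order_trans)
    then show "j \<in> PiE UNIV (\<lambda>_. {..n})" by auto
  qed
  show "finite (PiE (UNIV :: 's set) (\<lambda>_. {..n}))" by (intro finite_PiE) auto
qed

lemma mdeg_upd: "mdeg (j(i := a)) + j i = mdeg j + a"
  unfolding mdeg_def by (simp add: sum.remove[of UNIV i])

lemma mdeg_incr [simp]: "mdeg (j(i := Suc (j i))) = Suc (mdeg j)"
  using mdeg_upd[of j i "Suc (j i)"] by simp

definition degree_le :: "nat \<Rightarrow> (('s::finite \<Rightarrow> nat) \<Rightarrow> complex) \<Rightarrow> bool" where
  "degree_le n c \<longleftrightarrow> (\<forall>j. c j \<noteq> 0 \<longrightarrow> mdeg j \<le> n)"

lemma degree_le_mono: "degree_le m c \<Longrightarrow> m \<le> n \<Longrightarrow> degree_le n c"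
  unfolding degree_le_def by (blast intro: order_trans)

lemma degree_le_sum:
  assumes "\<And>a. a \<in> A \<Longrightarrow> degree_le n (c a)"
  shows "degree_le n (\<lambda>j. \<Sum>a\<in>A. b a * c a j)"
  unfolding degree_le_def
proof (intro allI impI)
  fix j assume "(\<Sum>a\<in>A. b a * c a j) \<noteq> 0"
  then obtain a where "a \<in> A" "b a * c a j \<noteq> 0" by (meson sum.neutral)
  then show "mdeg j \<le> n" using assms unfolding degree_le_def by auto
qed

lemma apply_functional_degree_le:
  assumes "degree_le n c"
  shows "apply_functional c x g = (\<Sum>j | mdeg j \<le> n. c j * pdiff j x g)"
  unfolding apply_functional_def
  by (rule sum.mono_neutral_left) (use assms finite_mdeg_le in \<open>auto simp: degree_le_def\<close>)

lemma apply_functional_sum: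
  assumes "finite A" "\<And>a. a \<in> A \<Longrightarrow> degree_le n (c a)"
  shows "apply_functional (\<lambda>j. \<Sum>a\<in>A. b a * c a j) x g = (\<Sum>a\<in>A. b a * apply_functional (c a) x g)"
proof -
  have "apply_functional (\<lambda>j. \<Sum>a\<in>A. b a * c a j) x g
      = (\<Sum>j | mdeg j \<le> n. \<Sum>a\<in>A. b a * (c a j * pdiff j x g))"
    by (subst apply_functional_degree_le[OF degree_le_sum[OF assms(2)]])
       (auto simp: sum_distrib_right mult.assoc)
  also have "\<dots> = (\<Sum>a\<in>A. \<Sum>j | mdeg j \<le> n. b a * (c a j * pdiff j x g))"
    by (rule sum.swap)
  also have "\<dots> = (\<Sum>a\<in>A. b a * apply_functional (c a) x g)"
    by (intro sum.cong refl) (simp add: apply_functional_degree_le[OF assms(2)] sum_distrib_left)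
  finally show ?thesis .
qed

text \<open>A family \<open>c\<close> stands for the polynomial \<open>\<Sum>\<^sub>j c\<^sub>j z\<^sup>j / j!\<close>; in this form \<open>\<phi>\<^sub>i\<close> is the derivative with
  respect to \<open>z\<^sub>i\<close>, and \<open>linear_mult v\<close> is multiplication by the linear form \<open>v \<cdot> z\<close>.\<close>

definition linear_mult :: "complex ^ 's::finite \<Rightarrow> (('s \<Rightarrow> nat) \<Rightarrow> complex) \<Rightarrow> ('s \<Rightarrow> nat) \<Rightarrow> complex" where
  "linear_mult v c j = (\<Sum>i\<in>UNIV. v $ i * (of_nat (j i) * c (j(i := j i - 1))))"

lemma degree_le_linear_mult:
  assumes "degree_le n c"
  shows "degree_le (Suc n) (linear_mult v c)"
  unfolding degree_le_def
proof (intro allI impI)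
  fix j assume "linear_mult v c j \<noteq> 0"
  then obtain i where "v $ i * (of_nat (j i) * c (j(i := j i - 1))) \<noteq> 0"
    unfolding linear_mult_def by (meson sum.neutral)
  then have "j i \<noteq> 0" "mdeg (j(i := j i - 1)) \<le> n" using assms by (auto simp: degree_le_def)
  then show "mdeg j \<le> Suc n" using mdeg_upd[of j i "j i - 1"] by simp
qed

text \<open>The substitution \<open>j \<mapsto> j + e\<^sub>i\<close> moves multiplication by a linear form from the coefficients \<open>c\<close> to
  the weights \<open>a\<close>. The weights will be the values \<open>\<partial>\<^sub>j g\<close>, or the monomials of highest degree.\<close>

lemma sum_linear_mult:
  fixes c a :: "('s::finite \<Rightarrow> nat) \<Rightarrow> complex"
  shows "(\<Sum>j | mdeg j \<le> Suc n. linear_mult v c j * a j)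
    = (\<Sum>i\<in>UNIV. v $ i * (\<Sum>j | mdeg j \<le> n. c j * (of_nat (j i + 1) * a (j(i := j i + 1)))))"
proof -
  have "(\<Sum>j | mdeg j \<le> Suc n. of_nat (j i) * c (j(i := j i - 1)) * a j)
      = (\<Sum>j | mdeg j \<le> n. c j * (of_nat (j i + 1) * a (j(i := j i + 1))))" (is "?L = ?R") for i
  proof -
    have "?L = (\<Sum>j | mdeg j \<le> Suc n \<and> j i > 0. of_nat (j i) * c (j(i := j i - 1)) * a j)"
      by (rule sum.mono_neutral_right) (use finite_mdeg_le in auto)
    also have "\<dots> = ?R"
    proof (rule sum.reindex_bij_witness[where i = "\<lambda>j. j(i := j i + 1)" and j = "\<lambda>j. j(i := j i - 1)"])
      fix j :: "'s \<Rightarrow> nat" assume j: "j \<in> {j. mdeg j \<le> Suc n \<and> j i > 0}"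
      then have "mdeg j \<le> Suc n" "0 < j i" by auto
      then show "j(i := j i - 1) \<in> {j. mdeg j \<le> n}"
        using mdeg_upd[of j i "j i - 1"] by simp
    qed (auto simp: algebra_simps)
    finally show ?thesis .
  qed
  then have "(\<Sum>i\<in>UNIV. v $ i * (\<Sum>j | mdeg j \<le> Suc n. of_nat (j i) * c (j(i := j i - 1)) * a j))
     = (\<Sum>i\<in>UNIV. v $ i * (\<Sum>j | mdeg j \<le> n. c j * (of_nat (j i + 1) * a (j(i := j i + 1)))))"
    by simp
  moreover have "(\<Sum>j | mdeg j \<le> Suc n. linear_mult v c j * a j)
     = (\<Sum>i\<in>UNIV. v $ i * (\<Sum>j | mdeg j \<le> Suc n. of_nat (j i) * c (j(i := j i - 1)) * a j))"
    unfolding linear_mult_def sum_distrib_left sum_distrib_right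
    by (subst sum.swap) (simp add: mult.assoc)
  ultimately show ?thesis by simp
qed

text \<open>Multiplication by \<open>v \<cdot> z\<close> corresponds to a derivative in direction \<open>v\<close> applied to the argument first.\<close>

lemma apply_functional_linear_mult:
  assumes "smooth_on U g" "x \<in> U" "degree_le n c"
  shows "apply_functional (linear_mult v c) x g = (\<Sum>i\<in>UNIV. v $ i * apply_functional c x (partial i g))"
  by (simp only: apply_functional_degree_le[OF degree_le_linear_mult[OF assms(3)]]
      apply_functional_degree_le[OF assms(3)] sum_linear_mult pdiff_incr[OF assms(1,2)])

text \<open>The product rule for \<open>\<partial>/\<partial>z\<^sub>i\<close> applied to \<open>(v \<cdot> z) c\<close>.\<close>

lemma antidiff_linear_mult:
  "antidiff i (linear_mult v c) j = v $ i * c j + linear_mult v (antidiff i c) j"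
proof -
  have "linear_mult v c (j(i := j i + 1)) = v $ i * (of_nat (j i + 1) * c j)
     + (\<Sum>l\<in>UNIV - {i}. v $ l * (of_nat (j l) * c ((j(l := j l - 1))(i := j i + 1))))"
    unfolding linear_mult_def
    by (subst sum.remove[of _ i]) (auto intro!: sum.cong simp: fun_upd_twist)
  moreover have "linear_mult v (antidiff i c) j = v $ i * (of_nat (j i) * c j)
     + (\<Sum>l\<in>UNIV - {i}. v $ l * (of_nat (j l) * c ((j(l := j l - 1))(i := j i + 1))))"
    unfolding linear_mult_def antidiff_def
    by (subst sum.remove[of _ i]) (cases "j i = 0"; auto intro!: sum.cong)+
  ultimately show ?thesis
    by (simp add: antidiff_def algebra_simps)
qed

lemma linear_mult_sum:
  "linear_mult v (\<lambda>j. \<Sum>a\<in>A. b a * c a j) j = (\<Sum>a\<in>A. b a * linear_mult v (c a) j)"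
  unfolding linear_mult_def sum_distrib_left
  by (subst sum.swap) (simp add: algebra_simps)

text \<open>The homogeneous part of degree \<open>n\<close> of \<open>\<Sum>\<^sub>j c\<^sub>j z\<^sup>j / j!\<close>, evaluated at \<open>w\<close>. The sum runs over all
  degrees up to \<open>n\<close> so that \<open>sum_linear_mult\<close> applies.\<close>

definition top_form :: "nat \<Rightarrow> (('s::finite \<Rightarrow> nat) \<Rightarrow> complex) \<Rightarrow> complex ^ 's \<Rightarrow> complex" where
  "top_form n c w = (\<Sum>j | mdeg j \<le> n. c j *
     (if mdeg j = n then (\<Prod>i\<in>UNIV. (w $ i) ^ j i / fact (j i)) else 0))"

lemma top_form_linear_mult:
  "top_form (Suc n) (linear_mult v c) w = (\<Sum>i\<in>UNIV. v $ i * w $ i) * top_form n c w"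
proof -
  have *: "of_nat (j i + 1) * (\<Prod>l\<in>UNIV. (w $ l) ^ (j(i := j i + 1)) l / fact ((j(i := j i + 1)) l))
      = w $ i * (\<Prod>l\<in>UNIV. (w $ l) ^ j l / fact (j l))" for j :: "'a \<Rightarrow> nat" and i
  proof -
    have key: "of_nat (j i + 1) * ((w $ i) ^ (j i + 1) / fact (j i + 1)) = w $ i * ((w $ i) ^ j i / fact (j i))"
    proof -
      have "of_nat (j i + 1) \<noteq> (0 :: complex)" using of_nat_neq_0[of "j i", where ?'a = complex] by simp
      then show ?thesis by (simp add: fact_reduce del: of_nat_add)
    qed
    have "(\<Prod>l\<in>UNIV. (w $ l) ^ (j(i := j i + 1)) l / fact ((j(i := j i + 1)) l))
       = (w $ i) ^ (j i + 1) / fact (j i + 1) * (\<Prod>l\<in>UNIV - {i}. (w $ l) ^ j l / fact (j l))"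
      by (subst prod.remove[of _ i]) (auto intro!: prod.cong)
    moreover have "(\<Prod>l\<in>UNIV. (w $ l) ^ j l / fact (j l))
       = (w $ i) ^ j i / fact (j i) * (\<Prod>l\<in>UNIV - {i}. (w $ l) ^ j l / fact (j l))"
      by (subst prod.remove[of _ i]) auto
    ultimately show ?thesis using key by (simp only: mult.assoc[symmetric])
  qed
  have **: "of_nat (j i + 1) * (if mdeg (j(i := j i + 1)) = Suc n
         then \<Prod>l\<in>UNIV. (w $ l) ^ (j(i := j i + 1)) l / fact ((j(i := j i + 1)) l) else 0)
      = w $ i * (if mdeg j = n then \<Prod>l\<in>UNIV. (w $ l) ^ j l / fact (j l) else 0)" for j :: "'a \<Rightarrow> nat" and i
    using *[of j i] by simp
  let ?P = "\<lambda>j. if mdeg j = n then \<Prod>l\<in>UNIV. (w $ l) ^ j l / fact (j l) else 0"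
  have "(\<Sum>j | mdeg j \<le> n. c j * (w $ i * ?P j)) = w $ i * top_form n c w" for i
    unfolding top_form_def sum_distrib_left by (intro sum.cong refl) (simp only: mult.left_commute)
  then show ?thesis
    unfolding top_form_def[of "Suc n"] sum_linear_mult **
    by (simp only: sum_distrib_right mult.assoc)
qed

lemma top_form_eq_0:
  assumes "degree_le m c" "m < n"
  shows "top_form n c w = 0"
  unfolding top_form_def
proof (rule sum.neutral, rule ballI)
  fix j :: "'a \<Rightarrow> nat" assume "j \<in> {j. mdeg j \<le> n}"
  show "c j * (if mdeg j = n then \<Prod>i\<in>UNIV. (w $ i) ^ j i / fact (j i) else 0) = 0"
  proof (cases "mdeg j = n")
    case True
    then have "c j = 0" using assms unfolding degree_le_def by (meson not_less)
    then show ?thesis by simp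
  qed simp
qed

lemma top_form_sum:
  "top_form n (\<lambda>j. \<Sum>a\<in>A. c a j) w = (\<Sum>a\<in>A. top_form n (c a) w)"
  unfolding top_form_def sum_distrib_right by (rule sum.swap)

lemma diff_order_ge:
  assumes "degree_le m c" "top_form n c w \<noteq> 0"
  shows "n \<le> diff_order c"
proof -
  have "\<exists>j. c j \<noteq> 0 \<and> mdeg j = n"
  proof (rule ccontr)
    assume "\<not> ?thesis"
    then have "top_form n c w = 0" unfolding top_form_def by (intro sum.neutral) auto
    with assms(2) show False by contradiction
  qed
  then obtain j where j: "c j \<noteq> 0" "mdeg j = n" by blast
  have "finite {j. c j \<noteq> 0}"
    by (rule finite_subset[OF _ finite_mdeg_le[of m]]) (use assms(1) in \<open>auto simp: degree_le_def\<close>)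
  moreover have "n \<in> mdeg ` {j. c j \<noteq> 0}" using j by blast
  ultimately show ?thesis unfolding diff_order_def by simp
qed

text \<open>Finitely many hyperplanes do not cover the space. A vector off all of them shows that
  a product of nonzero linear forms is not the zero polynomial.\<close>

lemma exists_off_hyperplanes:
  fixes V :: "(complex ^ 's::finite) set"
  assumes "finite V" "0 \<notin> V"
  shows "\<exists>w. \<forall>v\<in>V. (\<Sum>i\<in>UNIV. v $ i * w $ i) \<noteq> 0"
  using assms
proof (induction V rule: finite_induct)
  case (insert v V)
  let ?d = "\<lambda>v w :: complex ^ 's. \<Sum>i\<in>UNIV. v $ i * w $ i"
  obtain w where w: "\<And>u. u \<in> V \<Longrightarrow> ?d u w \<noteq> 0"
    using insert.IH insert.prems by blast
  obtain i where i: "v $ i \<noteq> 0" using insert.prems by (auto simp: vec_eq_iff)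
  define e :: "complex ^ 's" where "e = axis i 1"
  have de: "?d u e = u $ i" for u
  proof -
    have "u $ l * e $ l = (if l = i then u $ i else 0)" for l by (simp add: e_def axis_def)
    then show ?thesis by simp
  qed
  have lin: "?d u (w + t *s e) = ?d u w + t * u $ i" for u t
  proof -
    have "?d u (w + t *s e) = ?d u w + t * ?d u e"
      by (simp add: sum.distrib sum_distrib_left algebra_simps)
    then show ?thesis by (simp only: de)
  qed
  let ?bad = "(\<lambda>u. - ?d u w / u $ i) ` insert v V"
  have "finite ?bad" using insert.hyps by simp
  \<comment> \<open>On the line \<open>w + t e\<^sub>i\<close> every hyperplane is met for at most one \<open>t\<close>, because \<open>w\<close> lies off the old ones and \<open>e\<^sub>i\<close> off the new one.\<close>
  then obtain t where t: "t \<notin> ?bad"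
    using ex_new_if_finite[OF infinite_UNIV_char_0] by blast
  have "?d u (w + t *s e) \<noteq> 0" if u: "u \<in> insert v V" for u
  proof
    assume "?d u (w + t *s e) = 0"
    then have eq: "?d u w + t * u $ i = 0" by (simp only: lin)
    show False
    proof (cases "u $ i = 0")
      case True
      then have "u \<in> V" using u i by auto
      moreover have "?d u w = 0" using eq True by simp
      ultimately show False using w[of u] by simp
    next
      case False
      have "t * u $ i = - ?d u w" using eq by (simp add: add_eq_0_iff)
      then have "t = - ?d u w / u $ i" using False by (simp add: field_simps)
      then have "t \<in> ?bad" using u by (rule image_eqI)
      then show False using t by contradiction
    qed
  qed
  then show ?case by (intro exI[of _ "w + t *s e"] ballI)
qed simp

section \<open>Coefficients along a curve in nilpotent parameters\<close>

text \<open>The position of the block \<open>X\<^bsub>N\<^esub>\<close>: adding \<open>2\<^bsup>\<mu>-1\<^esup>\<close> to it, as \<open>\<Phi>\<^sub>\<mu>\<close> does, inserts \<open>\<mu>\<close> into \<open>N\<close>.\<close>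

definition subset_index :: "nat set \<Rightarrow> nat" where
  "subset_index N = (\<Sum>\<mu>\<in>N. 2 ^ (\<mu> - 1))"

lemma subset_index_insert:
  "finite N \<Longrightarrow> \<mu> \<notin> N \<Longrightarrow> subset_index (insert \<mu> N) = 2 ^ (\<mu> - 1) + subset_index N"
  by (simp add: subset_index_def)

lemma subset_index_single [simp]: "subset_index {m} = 2 ^ (m - 1)"
  by (simp add: subset_index_def)

lemma subset_index_less:
  assumes "N \<subseteq> {1..n}"
  shows "subset_index N < 2 ^ n"
proof -
  have "subset_index N \<le> (\<Sum>\<mu>\<in>{1..n}. 2 ^ (\<mu> - 1))"
    unfolding subset_index_def by (rule sum_mono2) (use assms in auto)
  also have "\<dots> = (\<Sum>k<n. 2 ^ k)"
    by (rule sum.reindex_bij_witness[where i = Suc and j = "\<lambda>m. m - 1"]) auto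
  also have "\<dots> < 2 ^ n"
    by (induction n) auto
  finally show ?thesis .
qed

lemma sum_Pow_insert:
  assumes "finite S" "\<mu> \<notin> S"
  shows "sum h (Pow (insert \<mu> S)) = (\<Sum>N\<in>Pow S. h N + h (insert \<mu> N))"
proof -
  have "inj_on (insert \<mu>) (Pow S)" using assms(2) by (auto simp: inj_on_def)
  then show ?thesis
    unfolding Pow_insert sum.distrib
    by (subst sum.union_disjoint) (use assms in \<open>auto simp: sum.reindex\<close>)
qed

lemma mdeg_zero [simp]: "mdeg (\<lambda>_. 0) = 0"
  by (simp add: mdeg_def)

lemma mdeg_le_0_iff: "mdeg j \<le> 0 \<longleftrightarrow> j = (\<lambda>_. 0)"
  by (auto simp: mdeg_def fun_eq_iff)

lemma pdiff_zero:
  fixes x :: "complex ^ 's::{finite,linorder}"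
  shows "pdiff (\<lambda>_. 0) x g = g x"
proof -
  have "foldr (\<lambda>i. partial i ^^ 0) L g = g" for L :: "'s list" by (induction L) auto
  then show ?thesis by (simp only: pdiff_def) simp
qed

text \<open>The coefficient of \<open>\<epsilon>\<^bsup>ms\<^esup>\<close> in \<open>g(\<Sum>\<^bsub>N\<^esub> X\<^bsub>N\<^esub> \<epsilon>\<^bsup>N\<^esup>)\<close>. By the chain rule the coefficient of \<open>\<epsilon>\<^sub>m\<close> in \<open>g(X(\<epsilon>))\<close> is
  \<open>\<Sum>\<^sub>i Z\<^sub>i (\<partial>\<^sub>i g)(X(\<epsilon>))\<close> with \<open>Z = \<Sum>\<^bsub>N\<^esub> X\<^bsub>N \<union> {m}\<^esub> \<epsilon>\<^bsup>N\<^esup>\<close>; the recursion collects the factors for the remaining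
  parameters. The recursion splits off the head of the list, because \<open>\<Phi>\<^sub>\<mu>\<close> appends the new parameter
  at its end: the first factor then stays the same when \<open>\<Phi>\<^sub>\<mu>\<close> is applied, up to \<open>\<mu>\<close> joining its subset.\<close>

fun taylor_coeff :: "nat list \<Rightarrow> (complex ^ 's::finite \<Rightarrow> complex) \<Rightarrow> 's blocks \<Rightarrow> complex" where
  "taylor_coeff [] g X = g (X 0)"
| "taylor_coeff (m # ms) g X = (\<Sum>N\<in>Pow (set ms). \<Sum>i\<in>UNIV.
     X (subset_index (insert m N)) $ i * taylor_coeff (filter (\<lambda>a. a \<notin> N) ms) (partial i g) X)"

text \<open>The differential functional \<open>g \<mapsto> taylor_coeff ms g X\<close>; the recursion is the same, with a partial
  derivative of the argument turned into multiplication by a linear form.\<close>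

fun taylor_functional :: "'s::finite blocks \<Rightarrow> nat list \<Rightarrow> ('s \<Rightarrow> nat) \<Rightarrow> complex" where
  "taylor_functional X [] = (\<lambda>j. if j = (\<lambda>_. 0) then 1 else 0)"
| "taylor_functional X (m # ms) = (\<lambda>j. \<Sum>N\<in>Pow (set ms).
     linear_mult (X (subset_index (insert m N))) (taylor_functional X (filter (\<lambda>a. a \<notin> N) ms)) j)"

lemma degree_le_taylor_functional: "degree_le (length ms) (taylor_functional X ms)"
proof (induction X ms rule: taylor_functional.induct)
  case (2 X m ms)
  have "degree_le (Suc (length ms)) (linear_mult (X (subset_index (insert m N)))
      (taylor_functional X (filter (\<lambda>a. a \<notin> N) ms)))" if "N \<in> Pow (set ms)" for N
    by (rule degree_le_mono[OF degree_le_linear_mult[OF "2.IH"[OF that]]]) simp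
  from degree_le_sum[of "Pow (set ms)" "Suc (length ms)" _ "\<lambda>_. 1", OF this]
  show ?case by simp
qed (simp add: degree_le_def)

lemma apply_taylor_functional:
  assumes "smooth_on U g" "X 0 \<in> U"
  shows "apply_functional (taylor_functional X ms) (X 0) g = taylor_coeff ms g X"
  using assms
proof (induction ms g X rule: taylor_coeff.induct)
  case (1 g X)
  have "{j. taylor_functional X [] j \<noteq> 0} = {\<lambda>_. 0}" by auto
  then show ?case by (simp add: apply_functional_def pdiff_zero)
next
  case (2 m ms g X)
  let ?c = "\<lambda>N. linear_mult (X (subset_index (insert m N))) (taylor_functional X (filter (\<lambda>a. a \<notin> N) ms))"
  have deg: "degree_le (Suc (length ms)) (?c N)" for N
    by (rule degree_le_mono[OF degree_le_linear_mult[OF degree_le_taylor_functional]]) simp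
  have "apply_functional (taylor_functional X (m # ms)) (X 0) g
     = (\<Sum>N\<in>Pow (set ms). apply_functional (?c N) (X 0) g)"
    using apply_functional_sum[of "Pow (set ms)" "Suc (length ms)" ?c "\<lambda>_. 1", OF _ deg] by simp
  also have "\<dots> = (\<Sum>N\<in>Pow (set ms). \<Sum>i\<in>UNIV. X (subset_index (insert m N)) $ i *
      apply_functional (taylor_functional X (filter (\<lambda>a. a \<notin> N) ms)) (X 0) (partial i g))"
    by (simp add: apply_functional_linear_mult[OF "2.prems" degree_le_taylor_functional])
  also have "\<dots> = taylor_coeff (m # ms) g X"
    using "2.IH"[OF _ _ smooth_on_partial[OF "2.prems"(1)] "2.prems"(2)] by simp
  finally show ?case .
qed

text \<open>In generating functions: the family of \<open>taylor_functional X ms\<close> is the coefficient of \<open>\<epsilon>\<^bsup>ms\<^esup>\<close> in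
  \<open>exp (h \<cdot> z)\<close> with \<open>h = \<Sum>\<^bsub>N \<noteq> \<emptyset>\<^esub> X\<^bsub>N\<^esub> \<epsilon>\<^bsup>N\<^esup>\<close>, and its derivative with respect to \<open>z\<^sub>i\<close> is \<open>h\<^sub>i exp (h \<cdot> z)\<close>. The subsets \<open>N\<close>
  with \<open>m \<in> N\<close> come from the derivative of the first linear factor, the others from the
  remaining factors.\<close>

lemma antidiff_taylor_functional:
  assumes "distinct ms"
  shows "antidiff i (taylor_functional X ms) j =
    (\<Sum>N\<in>Pow (set ms) - {{}}. X (subset_index N) $ i * taylor_functional X (filter (\<lambda>a. a \<notin> N) ms) j)"
  using assms
proof (induction X ms arbitrary: j rule: taylor_functional.induct)
  case (1 X)
  have "j(i := j i + 1) \<noteq> (\<lambda>_. 0)" by (metis fun_upd_same add_is_0 one_neq_zero)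
  then show ?case by (simp add: antidiff_def)
next
  case (2 X m ms)
  let ?S = "set ms"
  let ?v = "\<lambda>N. X (subset_index N)"
  let ?f = "\<lambda>N ms. filter (\<lambda>a. a \<notin> N) ms"
  have m: "m \<notin> ?S" using 2(2) by simp
  have IH: "antidiff i (taylor_functional X (?f N ms)) = (\<lambda>j. \<Sum>N'\<in>{N'\<in>Pow ?S - {{}}. N \<inter> N' = {}}.
      ?v N' $ i * taylor_functional X (?f N' (?f N ms)) j)" if N: "N \<in> Pow ?S" for N
  proof -
    have "Pow (set (?f N ms)) - {{}} = {N'\<in>Pow ?S - {{}}. N \<inter> N' = {}}" by auto
    then show ?thesis using "2.IH"[OF N] 2(2) by (simp add: fun_eq_iff)
  qed
  have "antidiff i (taylor_functional X (m # ms)) j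
     = (\<Sum>N\<in>Pow ?S. antidiff i (linear_mult (?v (insert m N)) (taylor_functional X (?f N ms))) j)"
    by (simp add: antidiff_def)
  also have "\<dots> = (\<Sum>N\<in>Pow ?S. ?v (insert m N) $ i * taylor_functional X (?f N ms) j)
     + (\<Sum>N\<in>Pow ?S. \<Sum>N'\<in>{N'\<in>Pow ?S - {{}}. N \<inter> N' = {}}.
          ?v N' $ i * linear_mult (?v (insert m N)) (taylor_functional X (?f N' (?f N ms))) j)"
    by (simp add: antidiff_linear_mult sum.distrib IH linear_mult_sum)
  also have "(\<Sum>N\<in>Pow ?S. \<Sum>N'\<in>{N'\<in>Pow ?S - {{}}. N \<inter> N' = {}}.
          ?v N' $ i * linear_mult (?v (insert m N)) (taylor_functional X (?f N' (?f N ms))) j)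
     = (\<Sum>N'\<in>Pow ?S - {{}}. \<Sum>N\<in>{N\<in>Pow ?S. N \<inter> N' = {}}.
          ?v N' $ i * linear_mult (?v (insert m N)) (taylor_functional X (?f N' (?f N ms))) j)"
    by (rule sum.swap_restrict) auto
  also have "\<dots> = (\<Sum>N'\<in>Pow ?S - {{}}. ?v N' $ i * taylor_functional X (m # ?f N' ms) j)"
  proof (rule sum.cong[OF refl])
    fix N' assume "N' \<in> Pow ?S - {{}}"
    have "{N\<in>Pow ?S. N \<inter> N' = {}} = Pow (set (?f N' ms))" by auto
    moreover have "?f N' (?f N ms) = ?f N (?f N' ms)" for N by (simp add: conj_commute)
    ultimately show "(\<Sum>N\<in>{N\<in>Pow ?S. N \<inter> N' = {}}.
          ?v N' $ i * linear_mult (?v (insert m N)) (taylor_functional X (?f N' (?f N ms))) j)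
        = ?v N' $ i * taylor_functional X (m # ?f N' ms) j"
      by (simp only: taylor_functional.simps sum_distrib_left)
  qed
  also have "(\<Sum>N\<in>Pow ?S. ?v (insert m N) $ i * taylor_functional X (?f N ms) j)
      + (\<Sum>N'\<in>Pow ?S - {{}}. ?v N' $ i * taylor_functional X (m # ?f N' ms) j)
    = (\<Sum>N\<in>Pow (set (m # ms)) - {{}}. ?v N $ i * taylor_functional X (?f N (m # ms)) j)"
  proof -
    have inj: "inj_on (insert m) (Pow ?S)" using m by (auto simp: inj_on_def)
    have split: "Pow (set (m # ms)) - {{}} = insert m ` Pow ?S \<union> (Pow ?S - {{}})"
      by (auto simp: Pow_insert)
    have 1: "?f (insert m N) (m # ms) = ?f N ms" for N
      using m by (auto intro: filter_cong)
    have 2: "?f N (m # ms) = m # ?f N ms" if "N \<in> Pow ?S - {{}}" for N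
      using m that by auto
    show ?thesis
      unfolding split
      by (subst sum.union_disjoint)
         (use m 1 2 in \<open>auto simp: sum.reindex[OF inj] simp del: taylor_functional.simps filter.simps\<close>)
  qed
  finally show ?case .
qed

text \<open>A subset \<open>N \<noteq> \<emptyset>\<close> uses up more than one parameter in a single factor, so only singletons
  contribute to the highest degree.\<close>

lemma top_form_taylor_functional:
  "top_form (length ms) (taylor_functional X ms) w = (\<Prod>m\<leftarrow>ms. \<Sum>i\<in>UNIV. X (2 ^ (m - 1)) $ i * w $ i)"
proof (induction ms)
  case Nil
  show ?case by (simp add: top_form_def mdeg_le_0_iff[simplified])
next
  case (Cons m ms)
  let ?c = "\<lambda>N. taylor_functional X (filter (\<lambda>a. a \<notin> N) ms)"
  let ?t = "\<lambda>N. (\<Sum>i\<in>UNIV. X (subset_index (insert m N)) $ i * w $ i) * top_form (length ms) (?c N) w"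
  have "top_form (length (m # ms)) (taylor_functional X (m # ms)) w = sum ?t (Pow (set ms))"
    by (simp add: top_form_sum top_form_linear_mult)
  also have "\<dots> = sum ?t {{}}"
  proof (rule sum.mono_neutral_right)
    show "\<forall>N\<in>Pow (set ms) - {{}}. ?t N = 0"
    proof
      fix N assume "N \<in> Pow (set ms) - {{}}"
      then obtain a where "a \<in> N" "a \<in> set ms" by auto
      then have "length (filter (\<lambda>a. a \<notin> N) ms) < length ms" by (intro length_filter_less) auto
      then show "?t N = 0" using top_form_eq_0[OF degree_le_taylor_functional] by (metis mult_zero_right)
    qed
  qed auto
  finally show ?case by (simp add: Cons.IH)
qed

section \<open>Membership in the dual space\<close>

lemma dual_upto_degree_le: "c \<in> dual_upto f x n \<Longrightarrow> degree_le n c"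
  by (cases n) (auto simp: degree_le_def mdeg_le_0_iff[simplified])

lemma dual_upto_sum:
  assumes "finite A" "\<And>a. a \<in> A \<Longrightarrow> c a \<in> dual_upto f x n"
  shows "(\<lambda>j. \<Sum>a\<in>A. b a * c a j) \<in> dual_upto f x n"
  using assms(2)
proof (induction n arbitrary: c)
  case 0
  then show ?case by auto
next
  case (Suc n)
  have deg: "degree_le (Suc n) (c a)" if "a \<in> A" for a
    using Suc.prems[OF that] by (rule dual_upto_degree_le)
  have "antidiff i (\<lambda>j. \<Sum>a\<in>A. b a * c a j) = (\<lambda>j. \<Sum>a\<in>A. b a * antidiff i (c a) j)" for i
    by (simp add: antidiff_def)
  moreover have "(\<lambda>j. \<Sum>a\<in>A. b a * antidiff i (c a) j) \<in> dual_upto f x n" for i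
    by (rule Suc.IH) (use Suc.prems in auto)
  moreover have "apply_functional (\<lambda>j. \<Sum>a\<in>A. b a * c a j) x (\<lambda>y. f y $ l) = 0" for l
    by (subst apply_functional_sum[OF assms(1) deg]) (use Suc.prems in auto)
  ultimately show ?case
    using degree_le_sum[of A "Suc n" c b, OF deg] by (simp add: degree_le_def)
qed

lemma dual_upto_Suc_mono:
  assumes "f x = 0"
  shows "dual_upto f x n \<subseteq> dual_upto f x (Suc n)"
proof (induction n)
  case 0
  show ?case
  proof
    fix c assume c: "c \<in> dual_upto f x 0"
    then have c0: "c j = 0" if "j \<noteq> (\<lambda>_. 0)" for j using that by simp
    have deg: "degree_le 0 c" using c by (rule dual_upto_degree_le)
    have "apply_functional c x (\<lambda>y. f y $ l) = 0" for l
      using assms by (simp add: apply_functional_degree_le[OF deg] mdeg_le_0_iff[simplified] pdiff_zero)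
    moreover have "antidiff i c j = 0" for i j
    proof -
      have "j(i := j i + 1) \<noteq> (\<lambda>_. 0)" by (metis fun_upd_same add_is_0 one_neq_zero)
      then show ?thesis by (simp add: antidiff_def c0)
    qed
    ultimately show "c \<in> dual_upto f x (Suc 0)"
      using degree_le_mono[OF deg, of "Suc 0"] by (simp add: degree_le_def)
  qed
next
  case (Suc n)
  show ?case
  proof
    fix c assume c: "c \<in> dual_upto f x (Suc n)"
    have "\<forall>i. antidiff i c \<in> dual_upto f x (Suc n)" using c Suc.IH by auto
    moreover have "\<forall>j. c j \<noteq> 0 \<longrightarrow> mdeg j \<le> Suc (Suc n)"
      "\<forall>l. apply_functional c x (\<lambda>y. f y $ l) = 0" using c by auto
    ultimately show "c \<in> dual_upto f x (Suc (Suc n))"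
      by (subst dual_upto.simps(2)) blast
  qed
qed

lemma dual_upto_mono:
  assumes "f x = 0" "m \<le> n"
  shows "dual_upto f x m \<subseteq> dual_upto f x n"
  using assms(2) by (induction rule: dec_induct) (use dual_upto_Suc_mono[of f x, OF assms(1)] in blast)+

text \<open>By \<open>antidiff_taylor_functional\<close> the maps \<open>\<phi>\<^sub>i\<close> lead to functionals of shorter lists, so annihilating
  \<open>f\<close> is the only condition left to assume, for all sorted lists over \<open>A\<close> at once.\<close>

lemma taylor_functional_in_dual_upto:
  assumes f: "f x = 0"
    and van: "\<And>ms l. distinct ms \<Longrightarrow> sorted ms \<Longrightarrow> set ms \<subseteq> A \<Longrightarrow>
      apply_functional (taylor_functional X ms) x (\<lambda>y. f y $ l) = 0"
    and ms: "distinct ms" "sorted ms" "set ms \<subseteq> A"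
  shows "taylor_functional X ms \<in> dual_upto f x (length ms)"
  using ms
proof (induction ms rule: length_induct)
  case (1 ms)
  show ?case
  proof (cases "length ms")
    case 0
    then show ?thesis by simp
  next
    case (Suc n)
    let ?I = "Pow (set ms) - {{}}"
    have "antidiff i (taylor_functional X ms) \<in> dual_upto f x n" for i
    proof -
      have "taylor_functional X (filter (\<lambda>a. a \<notin> N) ms) \<in> dual_upto f x n" if N: "N \<in> ?I" for N
      proof -
        from N obtain a where "a \<in> N" "a \<in> set ms" by auto
        then have less: "length (filter (\<lambda>a. a \<notin> N) ms) < length ms" by (intro length_filter_less) auto
        have "sorted (filter (\<lambda>a. a \<notin> N) ms)"
          using "1.prems"(2) by (rule sorted_wrt_filter)
        moreover have "distinct (filter (\<lambda>a. a \<notin> N) ms)" "set (filter (\<lambda>a. a \<notin> N) ms) \<subseteq> A"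
          using "1.prems" by auto
        ultimately have "taylor_functional X (filter (\<lambda>a. a \<notin> N) ms)
            \<in> dual_upto f x (length (filter (\<lambda>a. a \<notin> N) ms))"
          using 1(1) less by blast
        then show ?thesis using dual_upto_mono[of f x _ n, OF f] less Suc by (metis less_Suc_eq_le subsetD)
      qed
      moreover have "antidiff i (taylor_functional X ms) = (\<lambda>j. \<Sum>N\<in>?I. X (subset_index N) $ i *
          taylor_functional X (filter (\<lambda>a. a \<notin> N) ms) j)"
        using antidiff_taylor_functional[OF "1.prems"(1)] by blast
      ultimately show ?thesis by (simp only:) (rule dual_upto_sum, auto)
    qed
    moreover have "degree_le (Suc n) (taylor_functional X ms)"
      using degree_le_taylor_functional[of ms X] Suc by simp
    ultimately show ?thesis
      using van[OF "1.prems"] Suc by (simp add: degree_le_def)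
  qed
qed

section \<open>The chain rule\<close>

lemma taylor_coeff_differentiable:
  assumes "smooth_on U g" "X 0 \<in> U"
  shows "(\<lambda>z. taylor_coeff ms g (X(k := coord_upd (X k) i z))) field_differentiable at (X k $ i)"
  using assms
proof (induction ms g X rule: taylor_coeff.induct)
  case (1 g X)
  show ?case
  proof (cases "k = 0")
    case True
    then show ?thesis
      using smooth_on_has_partial[OF 1, of i] by (auto simp: field_differentiable_def)
  qed simp
next
  case (2 m ms g X)
  have coord: "(\<lambda>z. (X(k := coord_upd (X k) i z)) k' $ i') field_differentiable at (X k $ i)" for k' i'
    by (cases "k' = k"; cases "i' = i") auto
  show ?case
    unfolding taylor_coeff.simps
    by (intro field_differentiable_sum field_differentiable_mult coord "2.IH"
        smooth_on_partial[OF "2.prems"(1)] "2.prems"(2))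
qed

lemma taylor_coeff_has_block_partial:
  assumes "smooth_on U g" "X 0 \<in> U"
  shows "((\<lambda>z. taylor_coeff ms g (X(k := coord_upd (X k) i z)))
    has_field_derivative block_partial k i (taylor_coeff ms g) X) (at (X k $ i))"
  using taylor_coeff_differentiable[of U g X, OF assms]
  by (simp add: block_partial_def partial_def field_differentiable_derivI)

lemma block_partial_taylor_coeff_Cons:
  assumes "smooth_on U g" "X 0 \<in> U"
  shows "block_partial k i (taylor_coeff (m # ms) g) X =
    (\<Sum>N\<in>Pow (set ms). \<Sum>i'\<in>UNIV.
      (if subset_index (insert m N) = k \<and> i' = i then 1 else 0)
          * taylor_coeff (filter (\<lambda>a. a \<notin> N) ms) (partial i' g) X
      + X (subset_index (insert m N)) $ i'
          * block_partial k i (taylor_coeff (filter (\<lambda>a. a \<notin> N) ms) (partial i' g)) X)"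
proof -
  have coord: "((\<lambda>z. (X(k := coord_upd (X k) i z)) k' $ i') has_field_derivative
      (if k' = k \<and> i' = i then 1 else 0)) (at (X k $ i))" for k' i'
    by (cases "k' = k"; cases "i' = i") auto
  have "((\<lambda>z. (X(k := coord_upd (X k) i z)) k' $ i'
        * taylor_coeff ms' (partial i' g) (X(k := coord_upd (X k) i z))) has_field_derivative
      (if k' = k \<and> i' = i then 1 else 0) * taylor_coeff ms' (partial i' g) X
        + X k' $ i' * block_partial k i (taylor_coeff ms' (partial i' g)) X) (at (X k $ i))" for k' i' ms'
    using DERIV_mult[OF coord[of k' i'] taylor_coeff_has_block_partial[of U "partial i' g" X ms' k i,
        OF smooth_on_partial[OF assms(1)] assms(2)]]
    by (simp only: coord_upd_same fun_upd_triv mult.commute[of "block_partial _ _ _ _"])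
  then have "((\<lambda>z. taylor_coeff (m # ms) g (X(k := coord_upd (X k) i z))) has_field_derivative
    (\<Sum>N\<in>Pow (set ms). \<Sum>i'\<in>UNIV.
      (if subset_index (insert m N) = k \<and> i' = i then 1 else 0)
          * taylor_coeff (filter (\<lambda>a. a \<notin> N) ms) (partial i' g) X
      + X (subset_index (insert m N)) $ i'
          * block_partial k i (taylor_coeff (filter (\<lambda>a. a \<notin> N) ms) (partial i' g)) X)) (at (X k $ i))"
    unfolding taylor_coeff.simps by (intro DERIV_sum)
  then show ?thesis
    unfolding block_partial_def partial_def by (rule DERIV_imp_deriv)
qed

lemma Phi_taylor_coeff_Nil:
  "Phi \<mu> (taylor_coeff [] g) X = taylor_coeff [\<mu>] g X"
proof -
  have bp: "block_partial \<zeta> i (taylor_coeff [] g) X = (if \<zeta> = 0 then partial i g (X 0) else 0)" for \<zeta> i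
    by (simp add: block_partial_def partial_def)
  have "Phi \<mu> (taylor_coeff [] g) X = (\<Sum>\<zeta><(2::nat) ^ (\<mu> - 1). if \<zeta> = 0
      then \<Sum>i\<in>UNIV. X (2 ^ (\<mu> - 1)) $ i * partial i g (X 0) else 0)"
    unfolding Phi_def bp by (intro sum.cong) auto
  also have "\<dots> = taylor_coeff [\<mu>] g X" by simp
  finally show ?thesis .
qed

text \<open>\<open>\<Phi>\<^sub>\<mu>\<close> is a derivation sending the variable \<open>X\<^bsub>N\<^esub>\<close> to \<open>X\<^bsub>N \<union> {\<mu>}\<^esub>\<close>. In each product
  \<open>X\<^bsub>N \<union> {m}\<^esub> (\<dots>)\<close> of the recursion it hits either the first factor, which puts \<open>\<mu>\<close> into the subset
  of \<open>m\<close>, or the second one, where the induction hypothesis applies. These are the two kinds of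
  subsets in the recursion for \<open>ms @ [\<mu>]\<close>. The bound on \<open>ms\<close> says that only blocks below \<open>2\<^bsup>\<mu>-1\<^esup>\<close>
  occur, those over which \<open>\<Phi>\<^sub>\<mu>\<close> sums.\<close>

lemma Phi_taylor_coeff:
  assumes "smooth_on U g" "X 0 \<in> U" "distinct ms" "set ms \<subseteq> {1..\<mu> - 1}"
  shows "Phi \<mu> (taylor_coeff ms g) X = taylor_coeff (ms @ [\<mu>]) g X"
  using assms
proof (induction ms g X rule: taylor_coeff.induct)
  case (1 g X)
  show ?case using Phi_taylor_coeff_Nil[of \<mu> g X] by (simp only: append_Nil)
next
  case (2 m ms g X)
  let ?p = "2 ^ (\<mu> - 1) :: nat"
  let ?k = "\<lambda>N. subset_index (insert m N)"
  let ?f = "\<lambda>N ms. filter (\<lambda>a. a \<notin> N) ms"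
  let ?T = "\<lambda>N i'. taylor_coeff (?f N ms) (partial i' g)"
  let ?S = "set ms"
  have "\<mu> \<notin> set (m # ms)"
  proof
    assume "\<mu> \<in> set (m # ms)"
    then have "\<mu> \<in> {1..\<mu> - 1}" using "2.prems"(4) by (rule rev_subsetD)
    then show False by auto
  qed
  then have \<mu>: "\<mu> \<notin> ?S" "\<mu> \<noteq> m" "m \<notin> ?S" using "2.prems" by auto
  have fin: "finite N" if "N \<in> Pow ?S" for N using that finite_subset by auto
  have k_less: "?k N < ?p" if "N \<in> Pow ?S" for N
    using "2.prems"(4) that by (intro subset_index_less) auto
  have k_add: "?k (insert \<mu> N) = ?p + ?k N" if "N \<in> Pow ?S" for N
  proof -
    have "\<mu> \<notin> insert m N" using \<mu> that by auto
    then show ?thesis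
      using subset_index_insert[of "insert m N" \<mu>] fin[OF that] by (simp add: insert_commute)
  qed
  have IH: "Phi \<mu> (?T N i') X = taylor_coeff (?f N ms @ [\<mu>]) (partial i' g) X" if "N \<in> Pow ?S" for N i'
    by (rule "2.IH") (use that "2.prems" smooth_on_partial in auto)
  have delta: "(\<Sum>\<zeta><?p. \<Sum>i\<in>UNIV. X (?p + \<zeta>) $ i * (if ?k N = \<zeta> \<and> i' = i then 1 else 0)) = X (?p + ?k N) $ i'"
    if "N \<in> Pow ?S" for N i'
  proof -
    have "(\<Sum>\<zeta><?p. \<Sum>i\<in>UNIV. X (?p + \<zeta>) $ i * (if ?k N = \<zeta> \<and> i' = i then 1 else 0))
        = (\<Sum>\<zeta><?p. if ?k N = \<zeta> then X (?p + \<zeta>) $ i' else 0)"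
      by (intro sum.cong refl) (simp add: if_distrib[of "\<lambda>a. _ * a"] cong: if_cong)
    then show ?thesis using k_less[OF that] by simp
  qed
  have "Phi \<mu> (taylor_coeff (m # ms) g) X
     = (\<Sum>\<zeta><?p. \<Sum>i\<in>UNIV. \<Sum>N\<in>Pow ?S. \<Sum>i'\<in>UNIV.
         X (?p + \<zeta>) $ i * (if ?k N = \<zeta> \<and> i' = i then 1 else 0) * ?T N i' X
         + X (?k N) $ i' * (X (?p + \<zeta>) $ i * block_partial \<zeta> i (?T N i') X))"
    unfolding Phi_def block_partial_taylor_coeff_Cons[of U g X, OF "2.prems"(1,2)] sum_distrib_left
    by (simp only: distrib_left mult.assoc mult.left_commute)
  also have "\<dots> = (\<Sum>N\<in>Pow ?S. \<Sum>i'\<in>UNIV. \<Sum>\<zeta><?p. \<Sum>i\<in>UNIV.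
         X (?p + \<zeta>) $ i * (if ?k N = \<zeta> \<and> i' = i then 1 else 0) * ?T N i' X
         + X (?k N) $ i' * (X (?p + \<zeta>) $ i * block_partial \<zeta> i (?T N i') X))" (is "?L = ?R")
  proof -
    let ?h = "\<lambda>\<zeta> i N i'. X (?p + \<zeta>) $ i * (if ?k N = \<zeta> \<and> i' = i then 1 else 0) * ?T N i' X
         + X (?k N) $ i' * (X (?p + \<zeta>) $ i * block_partial \<zeta> i (?T N i') X)"
    have "?L = (\<Sum>\<zeta><?p. \<Sum>N\<in>Pow ?S. \<Sum>i\<in>UNIV. \<Sum>i'\<in>UNIV. ?h \<zeta> i N i')"
      by (rule sum.cong[OF refl]) (rule sum.swap)
    also have "\<dots> = (\<Sum>N\<in>Pow ?S. \<Sum>\<zeta><?p. \<Sum>i\<in>UNIV. \<Sum>i'\<in>UNIV. ?h \<zeta> i N i')"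
      by (rule sum.swap)
    also have "\<dots> = (\<Sum>N\<in>Pow ?S. \<Sum>\<zeta><?p. \<Sum>i'\<in>UNIV. \<Sum>i\<in>UNIV. ?h \<zeta> i N i')"
      by (rule sum.cong[OF refl], rule sum.cong[OF refl]) (rule sum.swap)
    also have "\<dots> = ?R" by (rule sum.cong[OF refl]) (rule sum.swap)
    finally show ?thesis .
  qed
  also have "\<dots> = (\<Sum>N\<in>Pow ?S. \<Sum>i'\<in>UNIV.
         X (?p + ?k N) $ i' * ?T N i' X + X (?k N) $ i' * Phi \<mu> (?T N i') X)"
    by (intro sum.cong refl)
       (simp only: sum.distrib sum_distrib_right[symmetric] sum_distrib_left[symmetric] delta Phi_def)
  also have "\<dots> = (\<Sum>N\<in>Pow ?S.
      (\<Sum>i'\<in>UNIV. X (?k N) $ i' * taylor_coeff (?f N (ms @ [\<mu>])) (partial i' g) X)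
      + (\<Sum>i'\<in>UNIV. X (?k (insert \<mu> N)) $ i' * taylor_coeff (?f (insert \<mu> N) (ms @ [\<mu>])) (partial i' g) X))"
  proof (intro sum.cong refl)
    fix N assume N: "N \<in> Pow ?S"
    have f1: "?f N (ms @ [\<mu>]) = ?f N ms @ [\<mu>]" using N \<mu> by auto
    have f2: "?f (insert \<mu> N) (ms @ [\<mu>]) = ?f N ms" using \<mu> by (auto intro: filter_cong)
    show "(\<Sum>i'\<in>UNIV. X (?p + ?k N) $ i' * ?T N i' X + X (?k N) $ i' * Phi \<mu> (?T N i') X)
      = (\<Sum>i'\<in>UNIV. X (?k N) $ i' * taylor_coeff (?f N (ms @ [\<mu>])) (partial i' g) X)
      + (\<Sum>i'\<in>UNIV. X (?k (insert \<mu> N)) $ i' * taylor_coeff (?f (insert \<mu> N) (ms @ [\<mu>])) (partial i' g) X)"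
      by (simp only: f1 f2 k_add[OF N] IH[OF N] sum.distrib add.commute)
  qed
  also have "\<dots> = taylor_coeff ((m # ms) @ [\<mu>]) g X"
    by (simp only: append_Cons taylor_coeff.simps set_append list.set Un_insert_right Un_empty_right)
       (rule sum_Pow_insert[OF finite_set \<mu>(1), symmetric])
  finally show ?case .
qed

lemma block_partial_cong_on:
  assumes "open U" "X 0 \<in> U" "\<And>X. X 0 \<in> U \<Longrightarrow> F X = G X"
  shows "block_partial k i F X = block_partial k i G X"
  unfolding block_partial_def partial_def
proof (rule deriv_cong_ev)
  have "\<forall>\<^sub>F z in nhds (X k $ i). (X(k := coord_upd (X k) i z)) 0 \<in> U"
    using eventually_coord_upd[OF assms(1), of "X 0" i] assms(2) by (cases "k = 0") auto
  then show "\<forall>\<^sub>F z in nhds (X k $ i). F (X(k := coord_upd (X k) i z)) = G (X(k := coord_upd (X k) i z))"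
    by eventually_elim (rule assms(3))
qed simp

text \<open>The identity holds for all points whose first block lies in \<open>U\<close>, not only at one point, since the
  next operator differentiates it again.\<close>

lemma fold_Phi_eq_taylor_coeff:
  assumes "smooth_on U g" "distinct ms" "sorted ms" "set ms \<subseteq> {1..n}" "X 0 \<in> U"
  shows "fold Phi ms (\<lambda>X. g (X 0)) X = taylor_coeff ms g X"
  using assms(2-5)
proof (induction ms arbitrary: X rule: rev_induct)
  case (snoc \<mu> ms)
  have "fold Phi ms (\<lambda>X. g (X 0)) X = taylor_coeff ms g X" if "X 0 \<in> U" for X
    using snoc that by (simp add: sorted_append)
  then have "block_partial \<zeta> i (fold Phi ms (\<lambda>X. g (X 0))) X = block_partial \<zeta> i (taylor_coeff ms g) X" for \<zeta> i
    by (intro block_partial_cong_on[of U X, OF smooth_on_open[OF assms(1)] snoc.prems(4)])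
  then have "fold Phi (ms @ [\<mu>]) (\<lambda>X. g (X 0)) X = Phi \<mu> (taylor_coeff ms g) X"
    by (simp add: Phi_def)
  also have "\<dots> = taylor_coeff (ms @ [\<mu>]) g X"
  proof (rule Phi_taylor_coeff[of U g X, OF assms(1) snoc.prems(4)])
    show "distinct ms" using snoc.prems by simp
    show "set ms \<subseteq> {1..\<mu> - 1}"
    proof
      fix a assume "a \<in> set ms"
      then have "a \<le> \<mu>" "a \<noteq> \<mu>" "1 \<le> a" using snoc.prems by (auto simp: sorted_append)
      then show "a \<in> {1..\<mu> - 1}" by auto
    qed
  qed
  finally show ?case .
qed simp

section \<open>Expanded systems\<close>

text \<open>The functions of \<open>n\<close> blocks. Evaluating them at a longer sequence of blocks changes nothing, so zeros of
  successive systems can be compared.\<close>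

definition depends_on :: "nat \<Rightarrow> ('s::finite blocks \<Rightarrow> complex) \<Rightarrow> bool" where
  "depends_on n F \<longleftrightarrow> (\<forall>X X'. (\<forall>k<n. X k = X' k) \<longrightarrow> F X = F X')"

lemma depends_onD: "depends_on n F \<Longrightarrow> (\<And>k. k < n \<Longrightarrow> X k = X' k) \<Longrightarrow> F X = F X'"
  unfolding depends_on_def by blast

lemma row_mult_cong:
  assumes "\<And>k. k < n \<Longrightarrow> r k = r' k" "\<And>k. k < n \<Longrightarrow> Y k = Y' k"
  shows "row_mult n r Y = row_mult n r' Y'"
  unfolding row_mult_def using assms by (intro sum.cong) auto

lemma sum_lessThan_add: "(\<Sum>k<n + m. h k) = (\<Sum>k<n. h k) + (\<Sum>k<m. h (n + k))"
  for h :: "nat \<Rightarrow> 'a::comm_monoid_add"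
  by (induction m) (auto simp: add.assoc)

lemma row_mult_add: "row_mult (n + m) r Y = row_mult n r Y + row_mult m (\<lambda>k. r (n + k)) (\<lambda>k. Y (n + k))"
  unfolding row_mult_def by (rule sum_lessThan_add)

lemma row_mult_zero_right: "(\<And>k. k < n \<Longrightarrow> Y k = 0) \<Longrightarrow> row_mult n r Y = 0"
  by (simp add: row_mult_def)

lemma row_mult_zero_left: "(\<And>k. k < n \<Longrightarrow> r k = 0) \<Longrightarrow> row_mult n r Y = 0"
  by (simp add: row_mult_def)

lemma row_mult_diff: "row_mult n r (\<lambda>k. Y k - Y' k) = row_mult n r Y - row_mult n r Y'"
  by (simp add: row_mult_def sum_subtractf[symmetric] algebra_simps)

lemma full_column_rank_iff:
  "full_column_rank n A \<longleftrightarrow> (\<forall>Y\<in>block_vecs n. (\<forall>r\<in>set A. row_mult n r Y = 0) \<longrightarrow> (\<forall>k. Y k = 0))"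
proof
  assume inj: "full_column_rank n A"
  show "\<forall>Y\<in>block_vecs n. (\<forall>r\<in>set A. row_mult n r Y = 0) \<longrightarrow> (\<forall>k. Y k = 0)"
  proof (intro ballI impI)
    fix Y :: "'a blocks" assume Y: "Y \<in> block_vecs n" "\<forall>r\<in>set A. row_mult n r Y = 0"
    then have "mat_mult n A Y = mat_mult n A (\<lambda>_. 0)"
      by (simp add: mat_mult_def row_mult_zero_right)
    moreover have "(\<lambda>_. 0) \<in> block_vecs n" by (simp add: block_vecs_def)
    ultimately have "Y = (\<lambda>_. 0)"
      using inj Y(1) unfolding full_column_rank_def by (blast dest: inj_onD)
    then show "\<forall>k. Y k = 0" by simp
  qed
next
  assume ker: "\<forall>Y\<in>block_vecs n. (\<forall>r\<in>set A. row_mult n r Y = 0) \<longrightarrow> (\<forall>k. Y k = 0)"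
  show "full_column_rank n A"
    unfolding full_column_rank_def
  proof (rule inj_onI)
    fix Y Y' :: "'a blocks"
    assume Y: "Y \<in> block_vecs n" "Y' \<in> block_vecs n" and eq: "mat_mult n A Y = mat_mult n A Y'"
    have "(\<lambda>k. Y k - Y' k) \<in> block_vecs n" using Y by (simp add: block_vecs_def)
    moreover have "\<forall>r\<in>set A. row_mult n r (\<lambda>k. Y k - Y' k) = 0"
      using eq by (simp add: row_mult_diff mat_mult_def)
    ultimately have "\<forall>k. Y k - Y' k = 0" using ker by blast
    then show "Y = Y'" by (simp add: fun_eq_iff)
  qed
qed

lemma gradient_cong:
  assumes F: "depends_on n F" and eq: "\<And>k. k < n \<Longrightarrow> X k = X' k" and k: "k < n"
  shows "gradient F X k = gradient F X' k"
proof -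
  have "F (X(k := coord_upd (X k) i z)) = F (X'(k := coord_upd (X' k) i z))" for i z
    by (rule depends_onD[OF F]) (use eq k in auto)
  then show ?thesis
    using eq[OF k] by (simp add: gradient_def block_partial_def partial_def)
qed

lemma gradient_beyond:
  assumes F: "depends_on n F" and k: "n \<le> k"
  shows "gradient F X k = 0"
proof -
  have "F (X(k := coord_upd (X k) i z)) = F X" for i z
    by (rule depends_onD[OF F]) (use k in auto)
  then show ?thesis
    by (simp add: gradient_def block_partial_def partial_def vec_eq_iff)
qed

text \<open>The equations added by an expansion are affine in the new blocks. It suffices that \<open>G\<close> has this form
  along the coordinate lines through \<open>Z\<close> in the new directions; along them the gradient of the old
  system does not move.\<close>

lemma gradient_row_mult_shift:
  assumes r: "\<And>k i z. k < n \<Longrightarrow> G (Z(n + k := coord_upd (Z (n + k)) i z))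
      = row_mult n r (\<lambda>l. (Z(n + k := coord_upd (Z (n + k)) i z)) (n + l)) - c"
    and k: "k < n"
  shows "gradient G Z (n + k) = r k"
proof -
  have "block_partial (n + k) i G Z = r k $ i" for i
    unfolding block_partial_def partial_def
  proof (rule DERIV_imp_deriv)
    have d: "((\<lambda>z. (Z(n + k := coord_upd (Z (n + k)) i z)) (n + l) $ i') has_field_derivative
        (if l = k \<and> i' = i then 1 else 0)) (at (Z (n + k) $ i))" for l i'
      by (cases "l = k"; cases "i' = i") auto
    have "((\<lambda>z. row_mult n r (\<lambda>l. (Z(n + k := coord_upd (Z (n + k)) i z)) (n + l)) - c)
       has_field_derivative (\<Sum>l<n. \<Sum>i'\<in>UNIV. r l $ i' * (if l = k \<and> i' = i then 1 else 0)) - 0)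
       (at (Z (n + k) $ i))"
      unfolding row_mult_def by (intro DERIV_diff DERIV_sum DERIV_cmult d DERIV_const)
    moreover have "(\<Sum>l<n. \<Sum>i'\<in>UNIV. r l $ i' * (if l = k \<and> i' = i then 1 else 0)) = r k $ i"
    proof -
      have "(\<Sum>l<n. \<Sum>i'\<in>UNIV. r l $ i' * (if l = k \<and> i' = i then 1 else 0))
          = (\<Sum>l<n. if l = k then r l $ i else 0)"
        by (intro sum.cong refl) (simp add: if_distrib[of "\<lambda>a. _ * a"] cong: if_cong)
      then show ?thesis using k by simp
    qed
    ultimately show "((\<lambda>z. G (Z(n + k := coord_upd (Z (n + k)) i z))) has_field_derivative r k $ i)
        (at (Z (n + k) $ i))"
      by (simp only: r[OF k] diff_zero)
  qed
  then show ?thesis by (simp add: gradient_def vec_eq_iff)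
qed

definition derived_eq :: "nat \<Rightarrow> ('s::finite blocks \<Rightarrow> complex) \<Rightarrow> 's blocks \<Rightarrow> complex" where
  "derived_eq n F X = row_mult n (gradient F X) (\<lambda>k. X (n + k))"

definition selected_eq :: "nat \<Rightarrow> 's::finite blocks list \<Rightarrow> nat \<Rightarrow> 's blocks \<Rightarrow> complex" where
  "selected_eq n A r X = row_mult n (A ! r) (\<lambda>k. X (n + k)) - unit_first (length A) ! r"

lemma set_expand_system:
  "set (expand_system n Fs A) = set Fs \<union> derived_eq n ` set Fs \<union> selected_eq n A ` {..<length A}"
  unfolding expand_system_def derived_eq_def[abs_def] selected_eq_def[abs_def]
  by (auto simp: lessThan_atLeast0)

lemma depends_on_expand_system:
  assumes "\<And>F. F \<in> set Fs \<Longrightarrow> depends_on n F" "G \<in> set (expand_system n Fs A)"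
  shows "depends_on (n + n) G"
  unfolding depends_on_def
proof (intro allI impI)
  fix X X' :: "'a blocks" assume eq: "\<forall>k<n + n. X k = X' k"
  from assms(2) consider "G \<in> set Fs" | F where "F \<in> set Fs" "G = derived_eq n F"
    | r where "G = selected_eq n A r" unfolding set_expand_system by blast
  then show "G X = G X'"
  proof cases
    case 1
    then show ?thesis by (intro depends_onD[OF assms(1)]) (use eq in auto)
  next
    case 2
    show ?thesis
      unfolding 2(2) derived_eq_def
      by (rule row_mult_cong) (use eq gradient_cong[OF assms(1)[OF 2(1)], of X X'] in auto)
  next
    case 3
    have "row_mult n (A ! r) (\<lambda>k. X (n + k)) = row_mult n (A ! r) (\<lambda>k. X' (n + k))"
      by (rule row_mult_cong) (use eq in auto)
    then show ?thesis by (simp add: 3 selected_eq_def)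
  qed
qed

lemma depends_on_deflated_system:
  "F \<in> set (deflated_system f R \<alpha>) \<Longrightarrow> depends_on (2 ^ \<alpha>) F"
proof (induction \<alpha> arbitrary: F)
  case 0
  then show ?case by (auto simp: depends_on_def)
next
  case (Suc \<alpha>)
  then show ?case
    using depends_on_expand_system[of "deflated_system f R \<alpha>" "2 ^ \<alpha>" F "R (Suc \<alpha>)"]
    by (simp add: mult_2)
qed

definition solves_linear :: "nat \<Rightarrow> ('s::finite blocks \<Rightarrow> complex) list \<Rightarrow> 's blocks list \<Rightarrow> 's blocks \<Rightarrow> 's blocks \<Rightarrow> bool" where
  "solves_linear n Fs A X Y \<longleftrightarrow> Y \<in> block_vecs n \<and>
     mat_mult n (jacobian Fs X @ A) Y = replicate (length (jacobian Fs X)) 0 @ unit_first (length A)"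

lemma solves_linear_iff:
  "solves_linear n Fs A X Y \<longleftrightarrow> Y \<in> block_vecs n \<and> (\<forall>F\<in>set Fs. row_mult n (gradient F X) Y = 0)
     \<and> (\<forall>r<length A. row_mult n (A ! r) Y = unit_first (length A) ! r)"
proof -
  have "map h Fs = replicate (length Fs) 0 \<longleftrightarrow> (\<forall>F\<in>set Fs. h F = 0)" for h :: "('a blocks \<Rightarrow> complex) \<Rightarrow> complex"
    by (induction Fs) auto
  then show ?thesis
    by (auto simp: solves_linear_def mat_mult_def jacobian_def unit_first_def list_eq_iff_nth_eq[of "map _ A"])
qed

lemma solves_linear_unique:
  assumes "full_column_rank n (jacobian Fs X @ A)" "solves_linear n Fs A X Y" "solves_linear n Fs A X Y'"
  shows "Y = Y'"
  using assms unfolding solves_linear_def full_column_rank_def by (metis inj_onD)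

definition first_blocks :: "nat \<Rightarrow> 's::finite blocks \<Rightarrow> 's blocks" where
  "first_blocks n Z = (\<lambda>k. if k < n then Z k else 0)"

lemma zeros_expand_system:
  assumes F: "\<And>F. F \<in> set Fs \<Longrightarrow> depends_on n F"
  shows "Z \<in> zeros (n + n) (expand_system n Fs A) \<longleftrightarrow>
    first_blocks n Z \<in> zeros n Fs \<and> solves_linear n Fs A (first_blocks n Z) (\<lambda>k. Z (n + k))"
proof -
  have "F Z = F (first_blocks n Z)" if "F \<in> set Fs" for F
    by (rule depends_onD[OF F[OF that]]) (simp add: first_blocks_def)
  then have "(\<forall>F\<in>set Fs. F Z = 0) \<longleftrightarrow> (\<forall>F\<in>set Fs. F (first_blocks n Z) = 0)"
    by (intro ball_cong refl arg_cong[where f = "\<lambda>a. a = 0"])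
  moreover have "derived_eq n F Z = row_mult n (gradient F (first_blocks n Z)) (\<lambda>k. Z (n + k))"
    if "F \<in> set Fs" for F
    unfolding derived_eq_def
    by (rule row_mult_cong[OF gradient_cong[OF F[OF that]]]) (auto simp: first_blocks_def)
  moreover have "Z \<in> block_vecs (n + n) \<longleftrightarrow> (\<lambda>k. Z (n + k)) \<in> block_vecs n"
    unfolding block_vecs_def by (auto simp: le_iff_add add.assoc)
  moreover have "first_blocks n Z \<in> block_vecs n"
    by (simp add: first_blocks_def block_vecs_def)
  ultimately show ?thesis
    unfolding zeros_def solves_linear_iff set_expand_system
    by (auto simp: selected_eq_def ball_Un)
qed

text \<open>The Jacobian of the expanded system is block lower triangular, with the old Jacobian in the upper left
  corner and the matrix of the linear system in the lower right one. The hypothesis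
  on the old system takes a kernel vector from a vanishing first block to a vanishing first half, and
  injectivity of the matrix in the corner kills the second half.\<close>

lemma kernel_expand_system:
  assumes F: "\<And>F. F \<in> set Fs \<Longrightarrow> depends_on n F"
    and n: "0 < n"
    and eq: "\<And>k. k < n \<Longrightarrow> Z k = X k"
    and rank: "full_column_rank n (jacobian Fs X @ A)"
    and IH: "\<And>V. V \<in> block_vecs n \<Longrightarrow> \<forall>F\<in>set Fs. row_mult n (gradient F X) V = 0 \<Longrightarrow> V 0 = 0 \<Longrightarrow> \<forall>k. V k = 0"
    and W: "W \<in> block_vecs (n + n)" "W 0 = 0"
    and ker: "\<forall>G\<in>set (expand_system n Fs A). row_mult (n + n) (gradient G Z) W = 0"
  shows "\<forall>k. W k = 0"
proof -
  let ?V = "first_blocks n W"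
  let ?W2 = "\<lambda>k. W (n + k)"
  have "row_mult n (gradient F X) ?V = 0" if FF: "F \<in> set Fs" for F
  proof -
    have "0 = row_mult (n + n) (gradient F Z) W"
      using ker FF by (auto simp: set_expand_system)
    also have "\<dots> = row_mult n (gradient F Z) W"
      by (simp add: row_mult_add row_mult_zero_left gradient_beyond[OF F[OF FF]])
    also have "\<dots> = row_mult n (gradient F X) ?V"
      by (rule row_mult_cong[OF gradient_cong[OF F[OF FF]]]) (auto simp: first_blocks_def eq)
    finally show ?thesis by simp
  qed
  moreover have "?V \<in> block_vecs n" "?V 0 = 0" using n W(2) by (auto simp: first_blocks_def block_vecs_def)
  ultimately have "\<forall>k. ?V k = 0" using IH by blast
  then have W1: "W k = 0" if "k < n" for k using that by (auto simp: first_blocks_def dest!: spec[of _ k])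
  have shift: "row_mult n r ?W2 = 0"
    if G: "G \<in> set (expand_system n Fs A)" and r: "\<And>k. k < n \<Longrightarrow> gradient G Z (n + k) = r k" for G r
  proof -
    have "0 = row_mult (n + n) (gradient G Z) W" using ker G by simp
    also have "\<dots> = row_mult n (\<lambda>k. gradient G Z (n + k)) ?W2"
      by (simp add: row_mult_add row_mult_zero_right W1)
    also have "\<dots> = row_mult n r ?W2" by (rule row_mult_cong) (auto simp: r)
    finally show ?thesis by simp
  qed
  have "row_mult n (gradient F X) ?W2 = 0" if FF: "F \<in> set Fs" for F
  proof (rule shift[where G = "derived_eq n F"])
    show "derived_eq n F \<in> set (expand_system n Fs A)" using FF by (auto simp: set_expand_system)
    fix k assume k: "k < n"
    show "gradient (derived_eq n F) Z (n + k) = gradient F X k"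
    proof (rule gradient_row_mult_shift[where c = 0, OF _ k])
      fix k i z
      let ?Z = "Z(n + k := coord_upd (Z (n + k)) i z)"
      have "row_mult n (gradient F ?Z) (\<lambda>l. ?Z (n + l)) = row_mult n (gradient F X) (\<lambda>l. ?Z (n + l))"
        by (rule row_mult_cong[OF gradient_cong[OF F[OF FF]]]) (auto simp: eq)
      then show "derived_eq n F ?Z = row_mult n (gradient F X) (\<lambda>l. ?Z (n + l)) - 0"
        by (simp only: derived_eq_def diff_zero)
    qed
  qed
  moreover have "row_mult n (A ! r) ?W2 = 0" if r: "r < length A" for r
  proof (rule shift[where G = "selected_eq n A r"])
    show "selected_eq n A r \<in> set (expand_system n Fs A)" using r by (auto simp: set_expand_system)
    fix k assume k: "k < n"
    show "gradient (selected_eq n A r) Z (n + k) = (A ! r) k"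
      by (rule gradient_row_mult_shift[OF _ k]) (simp only: selected_eq_def)
  qed
  ultimately have "\<forall>r\<in>set (jacobian Fs X @ A). row_mult n r ?W2 = 0"
    by (auto simp: jacobian_def in_set_conv_nth)
  moreover have "?W2 \<in> block_vecs n" using W(1) by (simp add: block_vecs_def)
  ultimately have W2: "W (n + k) = 0" for k using rank unfolding full_column_rank_iff by blast
  show ?thesis
  proof
    fix k show "W k = 0" using W1[of k] W2[of "k - n"] by (cases "k < n") auto
  qed
qed

section \<open>Solvability of the linear system\<close>

lemma vector_space_scale_blocks: "vector_space scale_blocks"
  by standard (auto simp: scale_blocks_def fun_eq_iff vec_eq_iff algebra_simps)

text \<open>The rows of \<open>A\<close> map the kernel of \<open>J\<close> injectively into a space whose dimension is the number
  of rows, which is the dimension of the kernel. So the map is onto. The target is realised as the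
  functions on the naturals that vanish from \<open>length A\<close> on.\<close>

lemma solvable_of_nullity:
  fixes J A :: "'s::finite blocks list"
  assumes rank: "full_column_rank n (J @ A)" and len: "length A = nullity n J"
  shows "\<exists>Y\<in>block_vecs n. (\<forall>r\<in>set J. row_mult n r Y = 0) \<and> (\<forall>r<length A. row_mult n (A ! r) Y = b r)"
proof -
  let ?m = "length A"
  define sc where "sc = (\<lambda>(a::complex) (h::nat \<Rightarrow> complex) k. a * h k)"
  interpret B: vector_space "scale_blocks :: complex \<Rightarrow> 's blocks \<Rightarrow> 's blocks"
    by (rule vector_space_scale_blocks)
  interpret C: vector_space sc
    by standard (auto simp: sc_def fun_eq_iff algebra_simps)
  interpret P: vector_space_pair "scale_blocks :: complex \<Rightarrow> 's blocks \<Rightarrow> 's blocks" sc ..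
  let ?K = "{Y \<in> block_vecs n. \<forall>r\<in>set J. row_mult n r Y = 0}"
  define T where "T = (\<lambda>(Y :: 's blocks) r. if r < ?m then row_mult n (A ! r) Y else 0)"
  have rm_add: "row_mult n r (Y + Y') = row_mult n r Y + row_mult n r Y'" for r Y Y'
    by (simp add: row_mult_def sum.distrib[symmetric] algebra_simps)
  have rm_sc: "row_mult n r (scale_blocks a Y) = a * row_mult n r Y" for r a Y
    by (simp add: row_mult_def scale_blocks_def sum_distrib_left algebra_simps)
  have linT: "Vector_Spaces.linear scale_blocks sc T"
    unfolding Vector_Spaces.linear_iff
    by (intro conjI B.vector_space_axioms C.vector_space_axioms)
       (auto simp: T_def sc_def fun_eq_iff rm_add rm_sc)
  have subK: "B.subspace ?K"
  proof (rule B.subspaceI)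
    show "scale_blocks a Y \<in> ?K" if "Y \<in> ?K" for a Y
      using that by (simp add: rm_sc) (simp add: block_vecs_def scale_blocks_def)
  qed (auto simp: block_vecs_def rm_add row_mult_zero_right)
  obtain B where B: "B \<subseteq> ?K" "B.independent B" "?K \<subseteq> B.span B" "card B = B.dim ?K"
    by (rule B.basis_exists)
  have spanB: "B.span B \<subseteq> ?K" by (rule B.span_minimal[OF B(1) subK])
  have injT: "inj_on T ?K"
  proof (rule inj_onI)
    fix Y Y' assume Y: "Y \<in> ?K" "Y' \<in> ?K" and eq: "T Y = T Y'"
    have "row_mult n (A ! r) Y = row_mult n (A ! r) Y'" if "r < ?m" for r
      using fun_cong[OF eq, of r] that by (simp add: T_def)
    then have "mat_mult n (J @ A) Y = mat_mult n (J @ A) Y'"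
      using Y by (auto simp: mat_mult_def in_set_conv_nth)
    then show "Y = Y'" using rank Y unfolding full_column_rank_def by (blast dest: inj_onD)
  qed
  define e where "e = (\<lambda>(r::nat) k. if k = r then 1 else 0 :: complex)"
  let ?E = "e ` {..<?m}"
  have in_span: "h \<in> C.span ?E" if h: "\<And>r. r \<ge> ?m \<Longrightarrow> h r = 0" for h
  proof -
    have sumf: "(\<Sum>r<m. sc (h r) (e r)) k = (if k < m then h k else 0)" for m k
      by (induction m) (auto simp: sc_def e_def less_Suc_eq)
    have "h = (\<Sum>r<?m. sc (h r) (e r))"
      using h by (auto simp: fun_eq_iff sumf)
    moreover have "(\<Sum>r<?m. sc (h r) (e r)) \<in> C.span ?E"
      by (intro C.span_sum C.span_scale C.span_base) auto
    ultimately show ?thesis by simp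
  qed
  have indT: "C.independent (T ` B)"
    by (rule P.linear_independent_injective_image[OF linT B(2)])
       (rule inj_on_subset[OF injT spanB])
  have TB: "T ` B \<subseteq> C.span ?E" by (auto intro!: in_span simp: T_def)
  have finE: "finite ?E" "card ?E \<le> ?m" using card_image_le[of "{..<?m}" e] by auto
  have finTB: "finite (T ` B)" using C.independent_span_bound[OF finE(1) indT TB] by blast
  have cardTB: "card (T ` B) = ?m"
    using card_image[OF inj_on_subset[OF injT B(1)]] B(4) len by (simp add: nullity_def)
  define t where "t = (\<lambda>r. if r < ?m then b r else 0)"
  \<comment> \<open>Otherwise \<open>t\<close> would extend the image of the basis to more independent vectors than the target space admits.\<close>
  have "t \<in> C.span (T ` B)"
  proof (rule ccontr)
    assume nt: "t \<notin> C.span (T ` B)"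
    have "C.independent (insert t (T ` B))"
      using C.independent_insertI[OF nt indT] .
    moreover have "insert t (T ` B) \<subseteq> C.span ?E"
      using TB by (auto intro!: in_span simp: t_def)
    ultimately have "card (insert t (T ` B)) \<le> card ?E"
      using C.independent_span_bound[OF finE(1)] by blast
    moreover have "t \<notin> T ` B" using nt C.span_base by blast
    ultimately show False using finTB cardTB finE(2) by simp
  qed
  then obtain Y where Y: "Y \<in> B.span B" "t = T Y"
    using P.linear_span_image[OF linT, of B] by auto
  have "row_mult n (A ! r) Y = b r" if "r < ?m" for r
    using fun_cong[OF Y(2), of r] that by (simp add: T_def t_def)
  then show ?thesis using Y(1) spanB by blast
qed

section \<open>The zeros of the deflation process\<close>

lemma Phi_eq_derived_eq: "Phi (Suc \<alpha>) F = derived_eq (2 ^ \<alpha>) F"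
  by (rule ext) (simp add: Phi_def derived_eq_def row_mult_def gradient_def mult.commute)

text \<open>The equations added by a step include the images under \<open>\<Phi>\<close> of the old ones, and the old ones are
  kept, so each parameter may or may not be used.\<close>

lemma fold_Phi_in_deflated_system:
  assumes "distinct ms" "sorted ms" "set ms \<subseteq> {1..\<sigma>}"
  shows "fold Phi ms (\<lambda>X. f (X 0) $ l) \<in> set (deflated_system f R \<sigma>)"
  using assms
proof (induction \<sigma> arbitrary: ms)
  case 0
  then show ?case by auto
next
  case (Suc \<sigma>)
  show ?case
  proof (cases "Suc \<sigma> \<in> set ms")
    case False
    have "set ms \<subseteq> {1..\<sigma>}"
    proof
      fix a assume a: "a \<in> set ms"
      then have "a \<noteq> Suc \<sigma>" "a \<in> {1..Suc \<sigma>}" using False Suc.prems(3) by blast+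
      then show "a \<in> {1..\<sigma>}" by auto
    qed
    then have "fold Phi ms (\<lambda>X. f (X 0) $ l) \<in> set (deflated_system f R \<sigma>)"
      using Suc.prems by (intro Suc.IH)
    then show ?thesis by (simp add: set_expand_system)
  next
    case True
    then obtain ms' \<mu> where ms: "ms = ms' @ [\<mu>]" by (cases ms rule: rev_cases) auto
    have \<mu>: "\<mu> = Suc \<sigma>"
    proof (rule antisym)
      show "\<mu> \<le> Suc \<sigma>" using Suc.prems(3) ms by auto
      show "Suc \<sigma> \<le> \<mu>" using True Suc.prems(2) ms by (auto simp: sorted_append)
    qed
    have "set ms' \<subseteq> {1..\<sigma>}"
    proof
      fix a assume a: "a \<in> set ms'"
      then have "a \<noteq> Suc \<sigma>" "1 \<le> a" "a \<le> Suc \<sigma>" using Suc.prems ms \<mu> by auto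
      then show "a \<in> {1..\<sigma>}" by auto
    qed
    then have "fold Phi ms' (\<lambda>X. f (X 0) $ l) \<in> set (deflated_system f R \<sigma>)"
      using Suc.prems ms by (intro Suc.IH) (auto simp: sorted_append)
    then show ?thesis by (simp add: ms \<mu> Phi_eq_derived_eq set_expand_system)
  qed
qed

lemma deflated_zero_Suc:
  "deflated_zero f x R (Suc \<alpha>) = (\<lambda>k. if k < 2 ^ \<alpha> then deflated_zero f x R \<alpha> k
     else (THE Y. solves_linear (2 ^ \<alpha>) (deflated_system f R \<alpha>) (R (Suc \<alpha>)) (deflated_zero f x R \<alpha>) Y)
       (k - 2 ^ \<alpha>))"
  unfolding solves_linear_def by (simp add: Let_def)

lemma deflated_zero_prefix:
  assumes "\<alpha> \<le> \<beta>" "k < 2 ^ \<alpha>"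
  shows "deflated_zero f x R \<beta> k = deflated_zero f x R \<alpha> k"
  using assms(1)
proof (induction rule: dec_induct)
  case (step \<beta>)
  have "k < 2 ^ \<beta>" using assms(2) step.hyps(1) by (meson less_le_trans one_le_numeral power_increasing)
  then show ?case using step.IH by (simp only: deflated_zero_Suc if_True)
qed simp

lemma deflated_zero_first: "deflated_zero f x R \<alpha> 0 = x"
  using deflated_zero_prefix[of 0 \<alpha> 0 f x R] by simp

text \<open>A multiple zero needs at least one extra row to reach full rank, so the right-hand side contains the
  entry 1 and the solution is not zero.\<close>

lemma solvable_step:
  assumes mult: "\<not> full_column_rank n (jacobian Fs X)"
    and len: "length A = nullity n (jacobian Fs X)"
    and rank: "full_column_rank n (jacobian Fs X @ A)"
  obtains Y where "\<forall>Y'. solves_linear n Fs A X Y' \<longleftrightarrow> Y' = Y" "\<exists>k. Y k \<noteq> 0"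
proof -
  obtain Y where "Y \<in> block_vecs n" "\<forall>r\<in>set (jacobian Fs X). row_mult n r Y = 0"
    "\<forall>r<length A. row_mult n (A ! r) Y = unit_first (length A) ! r"
    using solvable_of_nullity[OF rank len, of "\<lambda>r. unit_first (length A) ! r"] by blast
  then have Y: "solves_linear n Fs A X Y" by (simp add: solves_linear_iff jacobian_def)
  have "A \<noteq> []" using mult rank by auto
  then have "row_mult n (A ! 0) Y = 1"
    using Y by (simp add: solves_linear_iff unit_first_def)
  then have "\<exists>k. Y k \<noteq> 0" by (metis row_mult_zero_right zero_neq_one)
  moreover have "solves_linear n Fs A X Y' \<longleftrightarrow> Y' = Y" for Y'
    using solves_linear_unique[OF rank] Y by blast
  ultimately show ?thesis using that by blast
qed

context
  fixes f :: "complex ^ 's::{finite,linorder} \<Rightarrow> complex ^ 't::{finite,linorder}"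
    and x :: "complex ^ 's::{finite,linorder}" and R :: "nat \<Rightarrow> 's::{finite,linorder} blocks list"
  assumes adm: "admissible f x R" and fx: "f x = 0"
begin

abbreviation (input) "sys \<alpha> \<equiv> deflated_system f R \<alpha>"
abbreviation (input) "pt \<alpha> \<equiv> deflated_zero f x R \<alpha>"
abbreviation (input) "multiple_at \<alpha> \<equiv> multiple_zero (2 ^ \<alpha>) (sys \<alpha>) (pt \<alpha>)"

lemma step_solution:
  assumes "\<forall>\<beta>\<le>\<alpha>. multiple_at \<beta>"
  obtains Y where
    "\<forall>Y'. solves_linear (2 ^ \<alpha>) (sys \<alpha>) (R (Suc \<alpha>)) (pt \<alpha>) Y' \<longleftrightarrow> Y' = Y"
    "\<exists>k. Y k \<noteq> 0" "\<forall>k. pt (Suc \<alpha>) k = (if k < 2 ^ \<alpha> then pt \<alpha> k else Y (k - 2 ^ \<alpha>))"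
    "full_column_rank (2 ^ \<alpha>) (jacobian (sys \<alpha>) (pt \<alpha>) @ R (Suc \<alpha>))"
proof -
  have "length (R (Suc \<alpha>)) = nullity (2 ^ \<alpha>) (jacobian (sys \<alpha>) (pt \<alpha>))"
    and rank: "full_column_rank (2 ^ \<alpha>) (jacobian (sys \<alpha>) (pt \<alpha>) @ R (Suc \<alpha>))"
    using adm assms unfolding admissible_def Let_def by blast+
  moreover have "\<not> full_column_rank (2 ^ \<alpha>) (jacobian (sys \<alpha>) (pt \<alpha>))"
    using assms unfolding multiple_zero_def by blast
  ultimately obtain Y where Y: "\<forall>Y'. solves_linear (2 ^ \<alpha>) (sys \<alpha>) (R (Suc \<alpha>)) (pt \<alpha>) Y' \<longleftrightarrow> Y' = Y"
    "\<exists>k. Y k \<noteq> 0"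
    using solvable_step[of "2 ^ \<alpha>" "sys \<alpha>" "pt \<alpha>" "R (Suc \<alpha>)"] by blast
  have the: "(THE Y. solves_linear (2 ^ \<alpha>) (sys \<alpha>) (R (Suc \<alpha>)) (pt \<alpha>) Y) = Y"
    by (simp only: Y(1)) simp
  show ?thesis
  proof (rule that[OF Y _ rank])
    show "\<forall>k. pt (Suc \<alpha>) k = (if k < 2 ^ \<alpha> then pt \<alpha> k else Y (k - 2 ^ \<alpha>))"
      by (simp only: deflated_zero_Suc the) simp
  qed
qed

lemma deflated_zero_in_zeros:
  assumes "\<forall>\<beta><\<alpha>. multiple_at \<beta>"
  shows "pt \<alpha> \<in> zeros (2 ^ \<alpha>) (sys \<alpha>)"
proof (cases \<alpha>)
  case 0
  then show ?thesis using fx by (auto simp: zeros_def block_vecs_def)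
next
  case (Suc \<beta>)
  then have mult: "\<forall>\<gamma>\<le>\<beta>. multiple_at \<gamma>" using assms by auto
  obtain Y where Y: "\<forall>Y'. solves_linear (2 ^ \<beta>) (sys \<beta>) (R (Suc \<beta>)) (pt \<beta>) Y' \<longleftrightarrow> Y' = Y"
    "\<exists>k. Y k \<noteq> 0" "\<forall>k. pt (Suc \<beta>) k = (if k < (2 ^ \<beta>) then pt \<beta> k else Y (k - (2 ^ \<beta>)))"
    "full_column_rank (2 ^ \<beta>) (jacobian (sys \<beta>) (pt \<beta>) @ R (Suc \<beta>))"
    by (rule step_solution[OF mult])
  have prev: "pt \<beta> \<in> zeros (2 ^ \<beta>) (sys \<beta>)" using mult unfolding multiple_zero_def by blast
  then have "first_blocks (2 ^ \<beta>) (pt (Suc \<beta>)) = pt \<beta>"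
    unfolding first_blocks_def fun_eq_iff Y(3)[rule_format] by (auto simp: zeros_def block_vecs_def)
  moreover have "(\<lambda>k. pt (Suc \<beta>) (2 ^ \<beta> + k)) = Y" unfolding Y(3)[rule_format] by simp
  ultimately have "pt (Suc \<beta>) \<in> zeros (2 ^ \<beta> + 2 ^ \<beta>) (expand_system (2 ^ \<beta>) (sys \<beta>) (R (Suc \<beta>)))"
    using prev Y(1) by (subst zeros_expand_system) (auto intro: depends_on_deflated_system)
  then show ?thesis unfolding Suc deflated_system.simps(2) power_Suc mult_2 .
qed

text \<open>Closeness is used for the first block only; all other blocks are determined by linear systems of full
  column rank.\<close>

lemma zero_near_unique:
  assumes T: "T \<inter> {y. f y = 0} = {x}"
    and mult: "\<forall>\<beta><\<alpha>. multiple_at \<beta>"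
    and Z: "Z \<in> zeros (2 ^ \<alpha>) (sys \<alpha>)" "Z 0 \<in> T"
  shows "Z = pt \<alpha>"
  using mult Z
proof (induction \<alpha> arbitrary: Z)
  case 0
  have "f (Z 0) $ l = 0" for l using 0(2) by (auto simp: zeros_def)
  then have "f (Z 0) = 0" by (simp add: vec_eq_iff)
  then have "Z 0 = x" using T 0(3) by blast
  then show ?case using 0(2) by (auto simp: zeros_def block_vecs_def fun_eq_iff)
next
  case (Suc \<alpha>)
  let ?n = "2 ^ \<alpha>"
  have mult: "\<forall>\<gamma>\<le>\<alpha>. multiple_at \<gamma>" using Suc.prems(1) by auto
  obtain Y where Y: "\<forall>Y'. solves_linear ?n (sys \<alpha>) (R (Suc \<alpha>)) (pt \<alpha>) Y' \<longleftrightarrow> Y' = Y"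
    "\<exists>k. Y k \<noteq> 0" "\<forall>k. pt (Suc \<alpha>) k = (if k < ?n then pt \<alpha> k else Y (k - ?n))"
    "full_column_rank ?n (jacobian (sys \<alpha>) (pt \<alpha>) @ R (Suc \<alpha>))"
    by (rule step_solution[OF mult])
  have "Z \<in> zeros (?n + ?n) (expand_system ?n (sys \<alpha>) (R (Suc \<alpha>)))"
    using Suc.prems(2) unfolding deflated_system.simps(2) power_Suc mult_2 .
  then have Z: "first_blocks ?n Z \<in> zeros ?n (sys \<alpha>)"
    "solves_linear ?n (sys \<alpha>) (R (Suc \<alpha>)) (first_blocks ?n Z) (\<lambda>k. Z (?n + k))"
    by (auto simp: zeros_expand_system depends_on_deflated_system)
  have Z1: "first_blocks ?n Z = pt \<alpha>"
  proof (rule Suc.IH[OF _ Z(1)])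
    show "\<forall>\<beta><\<alpha>. multiple_at \<beta>" using mult by auto
    show "first_blocks ?n Z 0 \<in> T" using Suc.prems(3) by (simp add: first_blocks_def)
  qed
  then have Z2: "(\<lambda>k. Z (?n + k)) = Y" using Z(2) Y(1) by metis
  show ?case
  proof
    fix k
    show "Z k = pt (Suc \<alpha>) k"
    proof (cases "k < ?n")
      case True
      then show ?thesis using fun_cong[OF Z1, of k] by (simp only: Y(3)[rule_format]) (simp add: first_blocks_def)
    next
      case False
      then show ?thesis using fun_cong[OF Z2, of "k - ?n"] by (simp only: Y(3)[rule_format]) simp
    qed
  qed
qed

text \<open>A kernel vector of any of the Jacobians is determined by its first block of \<open>s\<close> coordinates: by
  induction its first half vanishes, and \<open>kernel_expand_system\<close> does the rest.\<close>

lemma kernel_first_block: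
  assumes "\<forall>\<beta><\<alpha>. multiple_at \<beta>"
    and "W \<in> block_vecs (2 ^ \<alpha>)" "\<forall>F\<in>set (sys \<alpha>). row_mult (2 ^ \<alpha>) (gradient F (pt \<alpha>)) W = 0" "W 0 = 0"
  shows "\<forall>k. W k = 0"
  using assms
proof (induction \<alpha> arbitrary: W)
  case 0
  show ?case
  proof
    fix k show "W k = 0" using 0(2,4) by (cases k) (auto simp: block_vecs_def)
  qed
next
  case (Suc \<alpha>)
  have mult: "\<forall>\<gamma>\<le>\<alpha>. multiple_at \<gamma>" using Suc.prems(1) by auto
  have rank: "full_column_rank (2 ^ \<alpha>) (jacobian (sys \<alpha>) (pt \<alpha>) @ R (Suc \<alpha>))"
    by (rule step_solution[OF mult]) assumption
  show ?case
  proof (rule kernel_expand_system[where Fs = "sys \<alpha>" and n = "2 ^ \<alpha>" and Z = "pt (Suc \<alpha>)" and X = "pt \<alpha>"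
        and A = "R (Suc \<alpha>)"])
    show "pt (Suc \<alpha>) k = pt \<alpha> k" if "k < 2 ^ \<alpha>" for k
      using that by (intro deflated_zero_prefix) auto
    show "\<forall>k. V k = 0" if "V \<in> block_vecs (2 ^ \<alpha>)"
      "\<forall>F\<in>set (sys \<alpha>). row_mult (2 ^ \<alpha>) (gradient F (pt \<alpha>)) V = 0" "V 0 = 0" for V
      using Suc.IH[OF _ that] mult by auto
    show "W \<in> block_vecs (2 ^ \<alpha> + 2 ^ \<alpha>)"
      using Suc.prems(2) unfolding power_Suc mult_2 .
    show "\<forall>G\<in>set (expand_system (2 ^ \<alpha>) (sys \<alpha>) (R (Suc \<alpha>))).
        row_mult (2 ^ \<alpha> + 2 ^ \<alpha>) (gradient G (pt (Suc \<alpha>))) W = 0"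
      using Suc.prems(3) unfolding deflated_system.simps(2) power_Suc mult_2 .
  qed (use rank Suc.prems(4) depends_on_deflated_system in auto)
qed

text \<open>The solution of the linear system is a nonzero kernel vector of the Jacobian, so its first block, which is
  block \<open>2\<^sup>\<alpha>\<close> of the new zero, cannot vanish.\<close>

lemma new_block_nonzero:
  assumes "\<forall>\<beta>\<le>\<alpha>. multiple_at \<beta>"
  shows "pt (Suc \<alpha>) (2 ^ \<alpha>) \<noteq> 0"
proof -
  obtain Y where Y: "\<forall>Y'. solves_linear (2 ^ \<alpha>) (sys \<alpha>) (R (Suc \<alpha>)) (pt \<alpha>) Y' \<longleftrightarrow> Y' = Y"
    "\<exists>k. Y k \<noteq> 0" "\<forall>k. pt (Suc \<alpha>) k = (if k < 2 ^ \<alpha> then pt \<alpha> k else Y (k - 2 ^ \<alpha>))"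
    "full_column_rank (2 ^ \<alpha>) (jacobian (sys \<alpha>) (pt \<alpha>) @ R (Suc \<alpha>))"
    by (rule step_solution[OF assms])
  have "solves_linear (2 ^ \<alpha>) (sys \<alpha>) (R (Suc \<alpha>)) (pt \<alpha>) Y" using Y(1) by blast
  then have "Y 0 \<noteq> 0"
    using kernel_first_block[of \<alpha> Y] assms Y(2) by (auto simp: solves_linear_iff)
  then show ?thesis by (simp only: Y(3)[rule_format]) simp
qed

lemma taylor_functional_in_dual_space:
  assumes smooth: "\<And>l. smooth_near x (\<lambda>y. f y $ l)"
    and mult: "\<forall>\<beta><\<sigma>. multiple_at \<beta>"
    and ms: "distinct ms" "sorted ms" "set ms \<subseteq> {1..\<sigma>}"
  shows "taylor_functional (pt \<sigma>) ms \<in> dual_space f x"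
proof -
  have "apply_functional (taylor_functional (pt \<sigma>) ms) x (\<lambda>y. f y $ l) = 0"
    if ms: "distinct ms" "sorted ms" "set ms \<subseteq> {1..\<sigma>}" for ms l
  proof -
    obtain U where U: "x \<in> U" "smooth_on U (\<lambda>y. f y $ l)"
      using smooth unfolding smooth_near_iff_smooth_on by blast
    have "apply_functional (taylor_functional (pt \<sigma>) ms) x (\<lambda>y. f y $ l) = taylor_coeff ms (\<lambda>y. f y $ l) (pt \<sigma>)"
      using apply_taylor_functional[OF U(2), of "pt \<sigma>"] U(1) by (simp add: deflated_zero_first)
    also have "\<dots> = fold Phi ms (\<lambda>X. f (X 0) $ l) (pt \<sigma>)"
      using fold_Phi_eq_taylor_coeff[OF U(2) ms, of "pt \<sigma>"] U(1) by (simp add: deflated_zero_first)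
    also have "\<dots> = 0"
      using deflated_zero_in_zeros[OF mult] fold_Phi_in_deflated_system[OF ms, of f l R]
      unfolding zeros_def by blast
    finally show ?thesis .
  qed
  from taylor_functional_in_dual_upto[OF fx this ms] show ?thesis
    unfolding dual_space_def by blast
qed

text \<open>This is where every step performed is seen to raise the order: \<open>X\<^bsub>{m}\<^esub>\<close> is the first block created by
  step \<open>m\<close>, and at a vector off the hyperplanes orthogonal to these blocks the form of degree \<open>\<sigma>\<close> is not zero.\<close>

lemma order_taylor_functional:
  assumes mult: "\<forall>\<beta><\<sigma>. multiple_at \<beta>"
  shows "\<sigma> \<le> diff_order (taylor_functional (pt \<sigma>) [1..<Suc \<sigma>])"
proof -
  let ?V = "(\<lambda>m. pt \<sigma> (2 ^ (m - 1))) ` {1..\<sigma>}"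
  have "pt \<sigma> (2 ^ (m - 1)) \<noteq> 0" if m: "m \<in> {1..\<sigma>}" for m
  proof -
    obtain \<alpha> where \<alpha>: "m = Suc \<alpha>" using m by (cases m) auto
    have "pt \<sigma> (2 ^ \<alpha>) = pt (Suc \<alpha>) (2 ^ \<alpha>)"
      by (rule deflated_zero_prefix) (use m \<alpha> in auto)
    moreover have "\<forall>\<beta>\<le>\<alpha>. multiple_at \<beta>" using mult m \<alpha> by auto
    ultimately show ?thesis using new_block_nonzero[of \<alpha>] \<alpha> by simp
  qed
  then have "0 \<notin> ?V" by force
  then obtain w where w: "\<forall>v\<in>?V. (\<Sum>i\<in>UNIV. v $ i * w $ i) \<noteq> 0"
    using exists_off_hyperplanes[of ?V] by blast
  have "0 \<notin> set (map (\<lambda>m. \<Sum>i\<in>UNIV. pt \<sigma> (2 ^ (m - 1)) $ i * w $ i) [1..<Suc \<sigma>])"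
  proof
    assume "0 \<in> set (map (\<lambda>m. \<Sum>i\<in>UNIV. pt \<sigma> (2 ^ (m - 1)) $ i * w $ i) [1..<Suc \<sigma>])"
    then obtain m where "m \<in> {1..\<sigma>}" "(\<Sum>i\<in>UNIV. pt \<sigma> (2 ^ (m - 1)) $ i * w $ i) = 0"
      unfolding set_map set_upt by (metis (no_types, lifting) imageE atLeastLessThanSuc_atLeastAtMost)
    then show False using w by blast
  qed
  then have "top_form (length [1..<Suc \<sigma>]) (taylor_functional (pt \<sigma>) [1..<Suc \<sigma>]) w \<noteq> 0"
    unfolding top_form_taylor_functional by (simp only: prod_list_zero_iff not_False_eq_True)
  then have "top_form \<sigma> (taylor_functional (pt \<sigma>) [1..<Suc \<sigma>]) w \<noteq> 0"
    by (simp del: upt_Suc)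
  then show ?thesis by (rule diff_order_ge[OF degree_le_taylor_functional])
qed

end

section \<open>Termination within the depth\<close>

theorem theorem4:
  fixes f :: "complex ^ 's::{finite,linorder} \<Rightarrow> complex ^ 't::{finite,linorder}"
    and x :: "complex ^ 's::{finite,linorder}"
    and R :: "nat \<Rightarrow> 's blocks list"
    and \<delta> :: nat
  assumes "CARD('t) \<ge> CARD('s)"
    and "\<And>l. smooth_near x (\<lambda>y. f y $ l)"
    and "x isolated_in {y. f y = 0}"
    and "has_depth f x \<delta>"
    and "admissible f x R"
  shows "\<exists>\<sigma>\<le>\<delta>.
    terminates_at f x R \<sigma> \<and>
    deflated_zero f x R \<sigma> isolated_in zeros (2 ^ \<sigma>) (deflated_system f R \<sigma>) \<and>
    deflated_zero f x R \<sigma> 0 = x \<and>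
    (\<forall>M \<subseteq> {1..\<sigma>}. \<exists>c\<in>dual_space f x. \<forall>g. smooth_near x g \<longrightarrow>
      apply_functional c x g = generated_functional M (deflated_zero f x R \<sigma>) g)"
proof -
  let ?X = "deflated_zero f x R"
  let ?multiple = "\<lambda>\<alpha>. multiple_zero (2 ^ \<alpha>) (deflated_system f R \<alpha>) (?X \<alpha>)"
  obtain T where T: "open T" "T \<inter> {y. f y = 0} = {x}"
    using assms(3) unfolding isolated_in_def by blast
  have fx: "f x = 0" using assms(3) unfolding isolated_in_def by blast
  note facts = assms(5) fx
  \<comment> \<open>With \<open>\<delta> + 1\<close> steps performed, the dual space would contain a functional of order \<open>\<delta> + 1\<close>.\<close>
  have "\<exists>\<alpha>\<le>\<delta>. \<not> ?multiple \<alpha>"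
  proof (rule ccontr)
    assume "\<not> ?thesis"
    then have mult: "\<forall>\<beta><Suc \<delta>. ?multiple \<beta>" by auto
    let ?c = "taylor_functional (?X (Suc \<delta>)) [1..<Suc (Suc \<delta>)]"
    have "?c \<in> dual_space f x"
      by (rule taylor_functional_in_dual_space[OF facts assms(2) mult]) (auto simp del: upt_Suc)
    then have "diff_order ?c \<le> \<delta>" using assms(4) unfolding has_depth_def by blast
    moreover have "Suc \<delta> \<le> diff_order ?c" by (rule order_taylor_functional[OF facts mult])
    ultimately show False by simp
  qed
  then obtain \<alpha> where \<alpha>: "\<alpha> \<le> \<delta>" "\<not> ?multiple \<alpha>" by blast
  define \<sigma> where "\<sigma> = (LEAST \<alpha>. \<not> ?multiple \<alpha>)"
  have \<sigma>: "\<sigma> \<le> \<delta>" "\<not> ?multiple \<sigma>" "\<forall>\<alpha><\<sigma>. ?multiple \<alpha>"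
    using LeastI[of "\<lambda>\<alpha>. \<not> ?multiple \<alpha>", OF \<alpha>(2)]
      Least_le[of "\<lambda>\<alpha>. \<not> ?multiple \<alpha>", OF \<alpha>(2)] \<alpha>(1)
      not_less_Least[of _ "\<lambda>\<alpha>. \<not> ?multiple \<alpha>"]
    unfolding \<sigma>_def[symmetric] by auto
  have zero: "?X \<sigma> \<in> zeros (2 ^ \<sigma>) (deflated_system f R \<sigma>)"
    by (rule deflated_zero_in_zeros[OF facts \<sigma>(3)])
  then have "terminates_at f x R \<sigma>"
    using \<sigma> unfolding terminates_at_def simple_zero_def multiple_zero_def by blast
  moreover have "?X \<sigma> isolated_in zeros (2 ^ \<sigma>) (deflated_system f R \<sigma>)"
  proof -
    have "open ((\<lambda>X :: 's blocks. X 0) -` T)"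
      by (intro open_vimage T(1) continuous_on_product_coordinates)
    moreover have "(\<lambda>X :: 's blocks. X 0) -` T \<inter> zeros (2 ^ \<sigma>) (deflated_system f R \<sigma>) = {?X \<sigma>}"
      using zero T(2) zero_near_unique[OF facts T(2) \<sigma>(3)] by (auto simp: deflated_zero_first)
    ultimately show ?thesis using zero unfolding isolated_in_def by blast
  qed
  moreover have "\<exists>c\<in>dual_space f x. \<forall>g. smooth_near x g \<longrightarrow>
      apply_functional c x g = generated_functional M (?X \<sigma>) g" if M: "M \<subseteq> {1..\<sigma>}" for M
  proof (intro bexI allI impI)
    let ?ms = "sorted_list_of_set M"
    have ms: "distinct ?ms" "sorted ?ms" "set ?ms \<subseteq> {1..\<sigma>}"
      using M finite_subset[OF M] by auto
    show "taylor_functional (?X \<sigma>) ?ms \<in> dual_space f x"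
      by (rule taylor_functional_in_dual_space[OF facts assms(2) \<sigma>(3) ms])
    fix g assume "smooth_near x g"
    then obtain U where U: "?X \<sigma> 0 \<in> U" "smooth_on U g"
      unfolding smooth_near_iff_smooth_on by (auto simp: deflated_zero_first)
    show "apply_functional (taylor_functional (?X \<sigma>) ?ms) x g = generated_functional M (?X \<sigma>) g"
      using apply_taylor_functional[OF U(2), of "?X \<sigma>" ?ms] fold_Phi_eq_taylor_coeff[of U g ?ms \<sigma> "?X \<sigma>", OF U(2) ms U(1)] U(1)
      by (simp add: generated_functional_def deflated_zero_first)
  qed
  ultimately show ?thesis using \<sigma>(1) by (auto simp: deflated_zero_first)
qed

end
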